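(* Let $d\ge 0$ be an integer and let $\mathcal{K}$ be the $d$-skeleton of a triangulated $(2d+1)$-sphere. Then $\mathcal{K}$ does not embed (topologically) in the $2d$-sphere $\mathbf{S}^{2d}$.
   Context: A triangulated $(2d+1)$-sphere is a finite simplicial complex whose underlying space is homeomorphic to the $(2d+1)$-sphere (not necessarily piecewise linear). The $d$-skeleton consists of all faces of dimension at most $d$. *)

theory Defs
  imports "HOL-Analysis.Analysis"
begin

definition simplicial_complex :: "'a set set \<Rightarrow> bool" where
  "simplicial_complex K \<longleftrightarrow> finite K \<and>
     (\<forall>\<sigma>\<in>K. finite \<sigma> \<and> \<sigma> \<noteq> {}) \<and>
     (\<forall>\<sigma>\<in>K. \<forall>\<tau>. \<tau> \<subseteq> \<sigma> \<and> \<tau> \<noteq> {} \<longrightarrow> \<tau> \<in> K)"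

definition geom_simplex :: "'a set \<Rightarrow> ('a \<Rightarrow> real) set" where
  "geom_simplex s = {x. (\<forall>v. 0 \<le> x v) \<and> (\<forall>v. v \<notin> s \<longrightarrow> x v = 0) \<and> sum x s = 1}"

text \<open>Geometric realization |K| as a subspace of the product space 'a => real
  (for a finite complex only finitely many coordinates are nonzero, so this is the
  usual Euclidean topology).\<close>
definition realization :: "'a set set \<Rightarrow> ('a \<Rightarrow> real) topology" where
  "realization K = subtopology (powertop_real UNIV) (\<Union>\<sigma>\<in>K. geom_simplex \<sigma>)"

definition skeleton :: "nat \<Rightarrow> 'a set set \<Rightarrow> 'a set set" where
  "skeleton d K = {\<sigma>\<in>K. card \<sigma> \<le> d + 1}"

definition triangulated_sphere :: "nat \<Rightarrow> 'a set set \<Rightarrow> bool" where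
  "triangulated_sphere n K \<longleftrightarrow> simplicial_complex K \<and> realization K homeomorphic_space nsphere n"

end

theory Submission
  imports Defs "HOL-Homology.Homology" "HOL-Library.Z2"
begin

text \<open>Put \<open>n = 2d + 1\<close> and let \<open>\<phi>\<close> be a homeomorphism from the \<open>n\<close>-sphere onto \<open>|K|\<close>. The map
  \<open>w(x) = \<phi>(x) - \<phi>(-x)\<close> is odd and nowhere zero. On a fine Kuhn triangulation of the boundary of a
  large cube, label each lattice point with a vertex of \<open>K\<close> at which \<open>w\<close> is large. The labels of
  a simplex then span a face of \<open>K\<close>, and the labels of the antipodal simplex span a disjoint one.

  A point \<open>y\<close> of the Kuhn triangulation is the average over \<open>s \<in> [0,1]\<close> of the lattice points
  \<open>\<lfloor>y + s\<rfloor>\<close>. Averaging the labels only over \<open>s \<in> [0,1/2]\<close> gives a continuous map \<open>p\<close> to \<open>|K|\<close>.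
  Negation exchanges the two halves of the interval and only \<open>n\<close> coordinates can jump, so \<open>p(y)\<close>
  and \<open>p(-y)\<close> lie in disjoint faces whose dimensions add up to at most \<open>n\<close>: one of them lies in
  the \<open>d\<close>-skeleton. This replaces an equivariant cellular approximation.

  An injective map of the \<open>d\<close>-skeleton to the \<open>2d\<close>-sphere extends to \<open>F : |K| \<rightarrow> \<real>\<^sup>n\<close> with \<open>|F| < 1\<close> off
  the skeleton, so \<open>F\<close> separates two distinct points as soon as one of them lies in the skeleton.
  Then \<open>F(p(y)) - F(p(-y))\<close> is odd without zeros, contradicting the Borsuk-Ulam theorem, which is
  proved by evaluating mod 2 cup products on an equivariant family of singular chains.\<close>

section \<open>The Borsuk-Ulam theorem\<close>

text \<open>These simp rules would rewrite field arithmetic on \<open>bit\<close> to bit operations.\<close>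

declare add_bit_eq_xor [simp del] mult_bit_eq_and [simp del] minus_bit_def [simp del]
  uminus_bit_def [simp del] power_bit_unfold [simp del]

section \<open>Cup products of mod 2 coboundaries\<close>

definition skip :: "nat \<Rightarrow> (nat \<Rightarrow> 'a) \<Rightarrow> nat \<Rightarrow> 'a" where
  "skip j v = (\<lambda>i. if i < j then v i else v (Suc i))"

text \<open>The cup product of the coboundaries of the 0-cochains \<open>s 0\<close>, ..., \<open>s (k - 1)\<close>.\<close>

definition cup :: "(nat \<Rightarrow> 'a \<Rightarrow> bit) \<Rightarrow> nat \<Rightarrow> (nat \<Rightarrow> 'a) \<Rightarrow> bit" where
  "cup s k v = (\<Prod>i<k. s i (v i) + s i (v (Suc i)))"

lemma bit_add_self [simp]: "x + x = (0::bit)"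
  by (cases x) auto

lemma cup_cong: "(\<And>i. i \<le> k \<Longrightarrow> v i = w i) \<Longrightarrow> cup s k v = cup s k w"
  unfolding cup_def by (rule prod.cong) auto

lemma cup_Suc: "cup s (Suc k) v = cup s k v * (s k (v k) + s k (v (Suc k)))"
  by (simp only: cup_def prod.lessThan_Suc)

text \<open>The faces that keep the last two vertices share the last factor, and the induction
  hypothesis sums the rest to \<open>cup s m v\<close>. The other two faces supply the remaining
  edges of the triangle \<open>v m\<close>, \<open>v (Suc m)\<close>,
  \<open>v (Suc (Suc m))\<close>, and the edge differences of a triangle add up to 0.\<close>

lemma cup_cocycle: "(\<Sum>j\<le>Suc m. cup s m (skip j v)) = 0"
proof (induction m arbitrary: v)
  case 0
  then show ?case by (simp add: cup_def)
next
  case (Suc m)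
  have "(\<Sum>j\<le>Suc (Suc m). cup s (Suc m) (skip j v))
      = (\<Sum>j<Suc m. cup s (Suc m) (skip j v)) + cup s (Suc m) (skip (Suc m) v)
        + cup s (Suc m) (skip (Suc (Suc m)) v)"
    by (simp add: lessThan_Suc_atMost)
  also have "(\<Sum>j<Suc m. cup s (Suc m) (skip j v))
      = (\<Sum>j<Suc m. cup s m (skip j v)) * (s m (v (Suc m)) + s m (v (Suc (Suc m))))"
    unfolding sum_distrib_right cup_Suc by (rule sum.cong) (auto simp: skip_def)
  also have "(\<Sum>j<Suc m. cup s m (skip j v)) = cup s m v"
  proof -
    have "(\<Sum>j<Suc m. cup s m (skip j v)) + cup s m (skip (Suc m) v) = 0"
      using Suc[of v] by (simp add: lessThan_Suc_atMost)
    moreover have "cup s m (skip (Suc m) v) = cup s m v"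
      by (rule cup_cong) (auto simp: skip_def)
    ultimately show ?thesis
      by (cases "cup s m v"; cases "(\<Sum>j<Suc m. cup s m (skip j v))") auto
  qed
  also have "cup s (Suc m) (skip (Suc m) v) = cup s m v * (s m (v m) + s m (v (Suc (Suc m))))"
  proof -
    have "cup s m (skip (Suc m) v) = cup s m v"
      by (rule cup_cong) (auto simp: skip_def)
    then show ?thesis by (simp only: cup_Suc) (simp only: skip_def, simp)
  qed
  also have "cup s (Suc m) (skip (Suc (Suc m)) v) = cup s m v * (s m (v m) + s m (v (Suc m)))"
  proof -
    have "cup s m (skip (Suc (Suc m)) v) = cup s m v"
      by (rule cup_cong) (auto simp: skip_def)
    then show ?thesis by (simp only: cup_Suc) (simp only: skip_def, simp)
  qed
  finally show ?case
    by (cases "cup s m v"; cases "s m (v m)"; cases "s m (v (Suc m))"; cases "s m (v (Suc (Suc m)))")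
      simp_all
qed

text \<open>This is the Leibniz rule: \<open>cup s m\<close> is a cocycle, so the coboundary of its
  product with the 0-cochain \<open>s m\<close> only differentiates the last factor. All faces but
  the last end in \<open>v (Suc m)\<close>.\<close>

lemma cup_coboundary:
  "(\<Sum>j\<le>Suc m. cup s m (skip j v) * s m (skip j v m)) = cup s (Suc m) v"
proof -
  have a: "cup s m (skip (Suc m) v) = cup s m v"
    by (rule cup_cong) (auto simp: skip_def)
  have "(\<Sum>j<Suc m. cup s m (skip j v)) + cup s m (skip (Suc m) v) = 0"
    using cup_cocycle[of s m v] by (simp add: lessThan_Suc_atMost)
  then have b: "(\<Sum>j<Suc m. cup s m (skip j v)) = cup s m v"
    by (cases "cup s m v"; cases "(\<Sum>j<Suc m. cup s m (skip j v))") (auto simp: a)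
  have "(\<Sum>j\<le>Suc m. cup s m (skip j v) * s m (skip j v m))
      = (\<Sum>j<Suc m. cup s m (skip j v) * s m (skip j v m)) + cup s m v * s m (v m)"
    by (simp add: lessThan_Suc_atMost a) (simp add: skip_def)
  also have "(\<Sum>j<Suc m. cup s m (skip j v) * s m (skip j v m))
      = (\<Sum>j<Suc m. cup s m (skip j v)) * s m (v (Suc m))"
    unfolding sum_distrib_right by (rule sum.cong) (auto simp: skip_def)
  finally show ?thesis
    by (simp only: b cup_Suc distrib_left add.commute)
qed

section \<open>Evaluating mod 2 cochains on integral singular chains\<close>

definition chain_eval :: "('b \<Rightarrow> bit) \<Rightarrow> ('b \<Rightarrow>\<^sub>0 int) \<Rightarrow> bit" where
  "chain_eval \<phi> c = (\<Sum>f\<in>Poly_Mapping.keys c. of_int (Poly_Mapping.lookup c f) * \<phi> f)"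

lemma chain_eval_superset:
  assumes "finite A" "Poly_Mapping.keys c \<subseteq> A"
  shows "chain_eval \<phi> c = (\<Sum>f\<in>A. of_int (Poly_Mapping.lookup c f) * \<phi> f)"
  unfolding chain_eval_def
  by (rule sum.mono_neutral_left) (use assms in \<open>auto simp: in_keys_iff\<close>)

lemma chain_eval_0 [simp]: "chain_eval \<phi> 0 = 0"
  by (simp add: chain_eval_def)

lemma chain_eval_of [simp]: "chain_eval \<phi> (frag_of f) = \<phi> f"
  by (simp add: chain_eval_def)

lemma chain_eval_diff: "chain_eval \<phi> (a - b) = chain_eval \<phi> a - chain_eval \<phi> b"
proof -
  let ?A = "Poly_Mapping.keys a \<union> Poly_Mapping.keys b"
  have "chain_eval \<phi> c = (\<Sum>f\<in>?A. of_int (Poly_Mapping.lookup c f) * \<phi> f)"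
    if "Poly_Mapping.keys c \<subseteq> ?A" for c
    by (rule chain_eval_superset) (use that in auto)
  then show ?thesis
    by (simp add: keys_diff lookup_minus left_diff_distrib sum_subtractf)
qed

lemma chain_eval_minus: "chain_eval \<phi> (- a) = chain_eval \<phi> a"
  using chain_eval_diff[of \<phi> 0 a] by (simp add: minus_bit_def)

lemma chain_eval_add: "chain_eval \<phi> (a + b) = chain_eval \<phi> a + chain_eval \<phi> b"
  using chain_eval_diff[of \<phi> a "- b"] by (simp add: chain_eval_minus minus_bit_def)

lemma chain_eval_sum: "chain_eval \<phi> (\<Sum>i\<in>I. g i) = (\<Sum>i\<in>I. chain_eval \<phi> (g i))"
  by (induction I rule: infinite_finite_induct) (auto simp: chain_eval_add)

text \<open>The chains have integer coefficients; modulo 2 the orientation signs in boundaries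
  disappear.\<close>

lemma chain_eval_sign: "chain_eval \<phi> (frag_cmul ((-1) ^ k) a) = chain_eval \<phi> a"
  by (cases "even k") (auto simp: chain_eval_minus)

lemma chain_eval_cong:
  "(\<And>f. f \<in> Poly_Mapping.keys c \<Longrightarrow> \<phi> f = \<psi> f) \<Longrightarrow> chain_eval \<phi> c = chain_eval \<psi> c"
  unfolding chain_eval_def by (rule sum.cong) auto

lemma chain_eval_plus_fun:
  "chain_eval (\<lambda>f. \<phi> f + \<psi> f) c = chain_eval \<phi> c + chain_eval \<psi> c"
  unfolding chain_eval_def by (simp add: ring_distribs sum.distrib)

lemma chain_eval_frag_extend:
  "chain_eval \<phi> (frag_extend b c) = chain_eval (\<lambda>x. chain_eval \<phi> (b x)) c"
  using subset_UNIV
  by (induction c rule: frag_induction) (auto simp: chain_eval_diff frag_extend_diff)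

lemma chain_eval_boundary:
  "chain_eval \<phi> (chain_boundary (Suc p) c)
    = chain_eval (\<lambda>f. \<Sum>k\<le>Suc p. \<phi> (singular_face (Suc p) k f)) c"
  unfolding chain_boundary_def
  by (simp add: chain_eval_frag_extend chain_eval_sum chain_eval_sign chain_eval_add del: power_Suc)

lemma chain_eval_chain_map:
  "chain_eval \<phi> (chain_map p g c) = chain_eval (\<lambda>f. \<phi> (simplex_map p g f)) c"
  unfolding chain_map_def by (simp add: chain_eval_frag_extend)

definition vertex :: "((nat \<Rightarrow> real) \<Rightarrow> 'a) \<Rightarrow> nat \<Rightarrow> 'a" where
  "vertex f i = f (\<lambda>j. if j = i then 1 else 0)"

lemma vertex_singular_face:
  assumes "i \<le> p"
  shows "vertex (singular_face (Suc p) k f) i = skip k (vertex f) i"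
proof -
  have "simplical_face k (\<lambda>j. if j = i then 1 else 0 :: real)
      = (\<lambda>j. if j = (if i < k then i else Suc i) then 1 else 0)"
    by (auto simp: simplical_face_def fun_eq_iff)
  then show ?thesis
    using assms by (simp add: vertex_def singular_face_def skip_def)
qed

lemma vertex_simplex_map: "i \<le> p \<Longrightarrow> vertex (simplex_map p g f) i = g (vertex f i)"
  by (simp add: vertex_def simplex_map_def)

lemma vertex_in_topspace:
  "singular_simplex p X f \<Longrightarrow> i \<le> p \<Longrightarrow> vertex f i \<in> topspace X"
  by (force simp: vertex_def singular_simplex_def continuous_map_def)

text \<open>By \<open>cup_coboundary\<close>, \<open>cup s (Suc k)\<close> is the coboundary of
  \<open>\<beta>\<close>, so its value on \<open>c (Suc k)\<close> is that of \<open>\<beta>\<close>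
  on \<open>c k\<close> plus its antipode. Since \<open>\<nu>\<close> flips every
  \<open>s j\<close>, it preserves their coboundaries, and \<open>\<beta>\<close> changes under
  \<open>\<nu>\<close> by \<open>cup s k\<close>. The value therefore descends unchanged to a single
  point, where it is 1.\<close>

lemma chain_eval_cup_eq_1:
  fixes c :: "nat \<Rightarrow> 'a chain"
  assumes ch: "\<And>k. k \<le> n \<Longrightarrow> singular_chain k X (c k)"
    and bd: "\<And>k. k < n \<Longrightarrow> chain_boundary (Suc k) (c (Suc k))
               = chain_map k \<nu> (c k) + frag_cmul ((-1) ^ Suc k) (c k)"
    and c0: "c 0 = frag_of f"
    and s: "\<And>k x. x \<in> topspace X \<Longrightarrow> s k (\<nu> x) = s k x + 1"
  shows "k \<le> n \<Longrightarrow> chain_eval (\<lambda>f. cup s k (vertex f)) (c k) = 1"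
proof (induction k)
  case 0
  then show ?case by (simp add: c0 cup_def)
next
  case (Suc k)
  define \<beta> where "\<beta> = (\<lambda>f. cup s k (vertex f) * s k (vertex f k))"
  have face: "(\<Sum>j\<le>Suc k. \<beta> (singular_face (Suc k) j f)) = cup s (Suc k) (vertex f)"
    for f :: "(nat \<Rightarrow> real) \<Rightarrow> 'a"
  proof -
    have "\<beta> (singular_face (Suc k) j f) = cup s k (skip j (vertex f)) * s k (skip j (vertex f) k)" for j
      using cup_cong[of k "vertex (singular_face (Suc k) j f)" "skip j (vertex f)" s]
      by (simp add: \<beta>_def vertex_singular_face)
    then show ?thesis by (simp only: cup_coboundary)
  qed
  have neg: "\<beta> f + \<beta> (simplex_map k \<nu> f) = cup s k (vertex f)" if "f \<in> Poly_Mapping.keys (c k)" for f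
  proof -
    have "singular_simplex k X f" using ch[of k] Suc.prems that by (auto simp: singular_chain_def)
    then have v: "s j (vertex (simplex_map k \<nu> f) i) = s j (vertex f i) + 1" if "i \<le> k" for i j
      using that s vertex_in_topspace by (fastforce simp: vertex_simplex_map)
    have "cup s k (vertex (simplex_map k \<nu> f)) = cup s k (vertex f)"
      unfolding cup_def by (rule prod.cong) (auto simp: v)
    moreover have "a * b + a * (b + 1) = a" for a b :: bit
      by (cases a; cases b) auto
    ultimately show ?thesis by (simp only: \<beta>_def v order_refl)
  qed
  have "chain_eval (\<lambda>f. cup s (Suc k) (vertex f)) (c (Suc k))
      = chain_eval \<beta> (chain_boundary (Suc k) (c (Suc k)))"
    by (simp only: chain_eval_boundary face)
  also have "\<dots> = chain_eval \<beta> (c k) + chain_eval \<beta> (chain_map k \<nu> (c k))"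
    using bd[of k] Suc.prems by (simp only: chain_eval_add chain_eval_sign Suc_le_eq add.commute)
  also have "\<dots> = chain_eval (\<lambda>f. \<beta> f + \<beta> (simplex_map k \<nu> f)) (c k)"
    by (simp add: chain_eval_chain_map chain_eval_plus_fun)
  also have "\<dots> = chain_eval (\<lambda>f. cup s k (vertex f)) (c k)"
    by (rule chain_eval_cong) (rule neg)
  also have "\<dots> = 1" using Suc by simp
  finally show ?case .
qed

section \<open>Subdivided and equivariant families of chains\<close>

lemma singular_subdivision_power_chain:
  "singular_chain p X c \<Longrightarrow> singular_chain p X ((singular_subdivision p ^^ m) c)"
  by (induction m) (auto simp: singular_chain_singular_subdivision)

lemma singular_subdivision_power_add:
  "(singular_subdivision p ^^ m) (a + b)
    = (singular_subdivision p ^^ m) a + (singular_subdivision p ^^ m) b"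
  by (induction m) (auto simp: singular_subdivision_add)

lemma singular_subdivision_power_sign:
  "(singular_subdivision p ^^ m) (frag_cmul ((-1) ^ k) a)
    = frag_cmul ((-1) ^ k) ((singular_subdivision p ^^ m) a)"
  using singular_subdivision_power_diff[where a = 0 and b = a and p = p and n = m] by (cases "even k") auto

lemma singular_subdivision_power_chain_map:
  assumes "singular_chain p X c"
  shows "(singular_subdivision p ^^ m) (chain_map p g c) = chain_map p g ((singular_subdivision p ^^ m) c)"
  by (induction m)
    (auto simp: naturality_singular_subdivision[OF singular_subdivision_power_chain[OF assms]])

lemma chain_boundary_singular_subdivision_power:
  assumes "singular_chain (Suc p) X c"
  shows "chain_boundary (Suc p) ((singular_subdivision (Suc p) ^^ m) c)
       = (singular_subdivision p ^^ m) (chain_boundary (Suc p) c)"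
  by (induction m)
    (auto simp: chain_boundary_singular_subdivision[OF singular_subdivision_power_chain[OF assms]])

text \<open>An equivariant family of chains exists because each sum or difference of a chain and its
  antipode is a cycle below the top dimension.\<close>

lemma involution_chains_exist:
  fixes X :: "'a topology"
  assumes \<nu>: "continuous_map X X \<nu>" "\<And>x. x \<in> topspace X \<Longrightarrow> \<nu> (\<nu> x) = x"
    and f: "singular_simplex 0 X f"
    and h0: "\<And>f f'. 0 < n \<Longrightarrow> singular_simplex 0 X f \<Longrightarrow> singular_simplex 0 X f'
               \<Longrightarrow> homologous_rel 0 X {} (frag_of f) (frag_of f')"
    and h: "\<And>p z. 0 < p \<Longrightarrow> p < n \<Longrightarrow> singular_relcycle p X {} z \<Longrightarrow> singular_relboundary p X {} z"
  obtains c where "\<And>k. k \<le> n \<Longrightarrow> singular_chain k X (c k)"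
    "\<And>k. k < n \<Longrightarrow> chain_boundary (Suc k) (c (Suc k))
               = chain_map k \<nu> (c k) + frag_cmul ((-1) ^ Suc k) (c k)"
    "c 0 = frag_of f"
proof -
  define R where "R = (\<lambda>k a b. singular_chain (Suc k) X b \<and> chain_boundary (Suc k) b
               = chain_map k \<nu> a + frag_cmul ((-1) ^ Suc k) a)"
  \<comment> \<open>The choice is made before a filling chain is known to exist; \<open>main\<close>
    supplies one in every degree below \<open>n\<close>.\<close>
  define c where "c = rec_nat (frag_of f) (\<lambda>k a. SOME b. R k a b)"
  have c0: "c 0 = frag_of f" by (simp add: c_def)
  have cS: "c (Suc k) = (SOME b. R k (c k) b)" for k by (simp add: c_def)
  have step: "R k (c k) (c (Suc k))" if "\<exists>b. R k (c k) b" for k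
    unfolding cS using that by (rule someI_ex)
  have main: "k < n \<Longrightarrow> singular_chain k X (c k) \<and> R k (c k) (c (Suc k))" for k
  proof (induction k)
    case 0
    have "homologous_rel 0 X {} (frag_of (simplex_map 0 \<nu> f)) (frag_of f)"
      using h0 0 f \<nu> singular_simplex_simplex_map by blast
    then have "\<exists>b. R 0 (c 0) b"
      by (simp add: homologous_rel_def singular_boundary R_def c0)
    then have "R 0 (c 0) (c (Suc 0))" by (rule step)
    then show ?case using f by (simp add: c0 singular_chain_of)
  next
    case (Suc k)
    define a b where "a = c k" and "b = c (Suc k)"
    have a: "singular_chain k X a" and b: "singular_chain (Suc k) X b"
      and ab: "chain_boundary (Suc k) b = chain_map k \<nu> a + frag_cmul ((-1) ^ Suc k) a"
      using Suc by (auto simp: a_def b_def R_def)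
    have aa: "chain_map k \<nu> (chain_map k \<nu> a) = a"
    proof -
      have "chain_map k \<nu> (chain_map k \<nu> a) = chain_map k (\<nu> \<circ> \<nu>) a"
        by (simp add: chain_map_compose)
      also have "\<dots> = a"
        using a \<nu>(2) by (intro chain_map_id_gen) auto
      finally show ?thesis .
    qed
    define z where "z = chain_map (Suc k) \<nu> b + frag_cmul ((-1) ^ Suc (Suc k)) b"
    have "singular_chain (Suc k) X z"
      unfolding z_def using b \<nu> by (intro singular_chain_add singular_chain_cmul singular_chain_chain_map)
    \<comment> \<open>\<open>\<nu>\<close> is an involution and consecutive degrees carry opposite
      signs, so the four terms cancel in pairs.\<close>
    moreover have "chain_boundary (Suc k) z = 0"
      unfolding z_def chain_boundary_add chain_boundary_cmul chain_boundary_chain_map[OF b] ab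
      by (cases "even k") (simp_all add: ab aa chain_map_add chain_map_minus chain_map_diff)
    ultimately have "singular_relcycle (Suc k) X {} z"
      by (simp add: singular_cycle)
    then have "singular_relboundary (Suc k) X {} z"
      using h Suc.prems by blast
    then have "\<exists>d. R (Suc k) b d"
      by (auto simp: singular_boundary R_def z_def)
    then show ?case using b step unfolding b_def by blast
  qed
  show ?thesis
  proof
    show "singular_chain k X (c k)" if "k \<le> n" for k
    proof (cases k)
      case 0
      then show ?thesis using f by (simp add: c0 singular_chain_of)
    next
      case (Suc j)
      then show ?thesis using main[of j] that by (simp add: R_def)
    qed
    show "chain_boundary (Suc k) (c (Suc k)) = chain_map k \<nu> (c k) + frag_cmul ((-1) ^ Suc k) (c k)"
      if "k < n" for k
      using main that by (simp add: R_def)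
  qed (rule c0)
qed

section \<open>Homology of the sphere below its dimension\<close>

lemma nsphere_homologous_0:
  assumes "0 < n" "singular_simplex 0 (nsphere n) f" "singular_simplex 0 (nsphere n) f'"
  shows "homologous_rel 0 (nsphere n) {} (frag_of f) (frag_of f')"
proof -
  let ?X = "nsphere n" and ?Y = "discrete_topology {()}"
  let ?z = "frag_of f - frag_of f'"
  have z: "singular_relcycle 0 ?X {} ?z"
    using assms by (simp add: singular_cycle singular_chain_diff singular_chain_of chain_boundary_def)
  \<comment> \<open>The map to a point kills the difference of the two vertices, which puts its
    class in the reduced group, trivial for \<open>0 < n\<close>.\<close>
  have "chain_map 0 (\<lambda>x. ()) ?z = 0"
    by (simp add: chain_map_diff simplex_map_def o_def)
  then have "hom_induced 0 ?X {} ?Y {} (\<lambda>x. ()) (homologous_rel_set 0 ?X {} ?z) = \<one>\<^bsub>homology_group 0 ?Y\<^esub>"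
    using hom_induced_chain_map[of ?X ?Y "\<lambda>x. ()" "{}" "{}" 0 ?z] z
      homologous_rel_set_eq_relboundary[of 0 ?Y "{}" 0] one_relative_homology_group[of 0 ?Y "{}"]
    by (simp add: continuous_map_def)
  then have "homologous_rel_set 0 ?X {} ?z \<in> carrier (reduced_homology_group 0 ?X)"
    using z by (auto simp: carrier_reduced_homology_group kernel_def carrier_relative_homology_group_0)
  moreover have "trivial_group (reduced_homology_group 0 ?X)"
    using assms(1) by (simp add: trivial_reduced_homology_group_nsphere)
  ultimately have "homologous_rel_set 0 ?X {} ?z = \<one>\<^bsub>homology_group 0 ?X\<^esub>"
    by (auto simp: trivial_group_def one_reduced_homology_group)
  then have "singular_relboundary 0 ?X {} ?z"
    using one_relative_homology_group[of 0 ?X "{}"] by (simp add: homologous_rel_set_eq_relboundary)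
  then show ?thesis by (simp add: homologous_rel_def)
qed

lemma nsphere_relboundary:
  assumes "0 < p" "p < n" "singular_relcycle p (nsphere n) {} z"
  shows "singular_relboundary p (nsphere n) {} z"
proof -
  have "trivial_group (homology_group (int p) (nsphere n))"
    using assms trivial_reduced_homology_group_nsphere[of "int p" n]
    by (simp add: un_reduced_homology_group)
  then have "homologous_rel_set p (nsphere n) {} ` singular_relcycle_set p (nsphere n) {}
      = {singular_relboundary_set p (nsphere n) {}}"
    by (simp add: trivial_group_def carrier_relative_homology_group)
  moreover have "homologous_rel_set p (nsphere n) {} z
      \<in> homologous_rel_set p (nsphere n) {} ` singular_relcycle_set p (nsphere n) {}"
    using assms(3) by (intro imageI) simp
  ultimately have "homologous_rel_set p (nsphere n) {} z = singular_relboundary_set p (nsphere n) {}"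
    by (simp only: singleton_iff)
  then show ?thesis by (simp add: homologous_rel_set_eq_relboundary)
qed

text \<open>A singular 0-cochain is an arbitrary function of points, so a discontinuous sign that is
  odd on nonzero vectors is allowed.\<close>

definition lead_sign :: "(nat \<Rightarrow> real) \<Rightarrow> bit" where
  "lead_sign x = of_bool (0 < x (LEAST i. x i \<noteq> 0))"

lemma lead_sign_neg:
  assumes "x i \<noteq> 0"
  shows "lead_sign (\<lambda>i. - x i) = lead_sign x + 1"
  using LeastI[of "\<lambda>i. x i \<noteq> 0", OF assms] by (auto simp: lead_sign_def)

lemma continuous_map_nsphere_uminus: "continuous_map (nsphere n) (nsphere n) (\<lambda>x i. - x i)"
  unfolding nsphere continuous_map_in_subtopology
  by (auto simp: continuous_map_componentwise_UNIV
      intro!: continuous_map_minus continuous_map_from_subtopology continuous_map_product_projection)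

text \<open>A 0-cochain \<open>s i\<close> is the sign of \<open>G i\<close>, made antipodal where \<open>G i\<close> vanishes. On a simplex so
  small that some \<open>G i\<close> has constant sign, the \<open>i\<close>-th factor of the cup product is zero.\<close>

theorem Borsuk_Ulam:
  fixes G :: "nat \<Rightarrow> (nat \<Rightarrow> real) \<Rightarrow> real"
  assumes cont: "\<And>i. i < n \<Longrightarrow> continuous_map (nsphere n) euclideanreal (G i)"
    and odd: "\<And>i x. i < n \<Longrightarrow> x \<in> topspace (nsphere n) \<Longrightarrow> G i (\<lambda>j. - x j) = - G i x"
  shows "\<exists>x \<in> topspace (nsphere n). \<forall>i<n. G i x = 0"
proof (rule ccontr)
  let ?X = "nsphere n"
  let ?\<nu> = "\<lambda>x i. - x i :: real"
  assume "\<not> ?thesis"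
  then have nz: "\<exists>i<n. G i x \<noteq> 0" if "x \<in> topspace ?X" for x using that by blast
  define s where "s = (\<lambda>i x. if i < n \<and> G i x \<noteq> 0 then of_bool (0 < G i x) else lead_sign x)"
  have s: "s i (?\<nu> x) = s i x + 1" if x: "x \<in> topspace ?X" for i x
  proof -
    have "\<exists>j. x j \<noteq> 0"
    proof (rule ccontr)
      assume "\<not> ?thesis"
      then have "(\<Sum>i\<le>n. (x i)\<^sup>2) = 0" by simp
      then show False using x by (simp add: nsphere)
    qed
    then have "lead_sign (?\<nu> x) = lead_sign x + 1" using lead_sign_neg by blast
    then show ?thesis using odd[OF _ x, of i] by (auto simp: s_def)
  qed
  define f where "f = restrict (\<lambda>_. (\<lambda>k::nat. if k = 0 then 1 else 0::real)) (standard_simplex 0)"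
  have f: "singular_simplex 0 ?X f"
    unfolding singular_simplex_def f_def
    using in_topspace_nsphere[of n] by auto
  obtain c where ch: "\<And>k. k \<le> n \<Longrightarrow> singular_chain k ?X (c k)"
    and bd: "\<And>k. k < n \<Longrightarrow> chain_boundary (Suc k) (c (Suc k))
               = chain_map k ?\<nu> (c k) + frag_cmul ((-1) ^ Suc k) (c k)"
    and c0: "c 0 = frag_of f"
  proof (rule involution_chains_exist[where n = n, OF continuous_map_nsphere_uminus[of n] _ f])
    show "homologous_rel 0 ?X {} (frag_of g) (frag_of g')"
      if "0 < n" "singular_simplex 0 ?X g" "singular_simplex 0 ?X g'" for g g'
      using that by (rule nsphere_homologous_0)
    show "singular_relboundary p ?X {} z" if "0 < p" "p < n" "singular_relcycle p ?X {} z" for p z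
      using that by (rule nsphere_relboundary)
  qed (simp, rule that)
  define W where "W = (\<lambda>i. {x \<in> topspace ?X. G i x \<in> {0<..}})"
  define W' where "W' = (\<lambda>i. {x \<in> topspace ?X. G i x \<in> {..<0}})"
  \<comment> \<open>After enough subdivisions each simplex lies in one open set on which some
    \<open>G i\<close> has constant sign.\<close>
  obtain m where m: "\<And>m' f. m \<le> m' \<Longrightarrow> f \<in> Poly_Mapping.keys ((singular_subdivision n ^^ m') (c n))
        \<Longrightarrow> \<exists>V \<in> W ` {..<n} \<union> W' ` {..<n}. f \<in> standard_simplex n \<rightarrow> V"
  proof (rule sufficient_iterated_singular_subdivision_exists[of "W ` {..<n} \<union> W' ` {..<n}" ?X n "c n"])
    have "openin ?X (W i)" "openin ?X (W' i)" if "i < n" for i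
      unfolding W_def W'_def
      by (intro openin_continuous_map_preimage[OF cont[OF that]], simp)+
    then show "openin ?X U" if "U \<in> W ` {..<n} \<union> W' ` {..<n}" for U
      using that by (elim UnE imageE) simp_all
    show "topspace ?X \<subseteq> \<Union> (W ` {..<n} \<union> W' ` {..<n})"
    proof
      fix x assume x: "x \<in> topspace ?X"
      then obtain i where "i < n" "G i x \<noteq> 0" using nz by blast
      then have "x \<in> W i \<or> x \<in> W' i" using x by (auto simp: W_def W'_def)
      then show "x \<in> \<Union> (W ` {..<n} \<union> W' ` {..<n})" using \<open>i < n\<close> by blast
    qed
  qed (use ch in auto)
  \<comment> \<open>Subdivision is natural and commutes with boundaries, so the relations between
    the chains survive; \<open>c' 0\<close> is still one point.\<close>
  define c' where "c' = (\<lambda>k. (singular_subdivision k ^^ m) (c k))"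
  have c0': "c' 0 = frag_of f"
  proof -
    have "(singular_subdivision 0 ^^ j) (frag_of f) = frag_of f" for j
      using f by (induction j) (auto simp: singular_subdivision_zero singular_chain_of)
    then show ?thesis by (simp add: c'_def c0)
  qed
  have "chain_eval (\<lambda>f. cup s n (vertex f)) (c' n) = 1"
  proof (rule chain_eval_cup_eq_1[where X = ?X and \<nu> = ?\<nu> and c = c' and f = f and n = n])
    show "singular_chain k ?X (c' k)" if "k \<le> n" for k
      using ch[OF that] by (simp add: c'_def singular_subdivision_power_chain)
    show "chain_boundary (Suc k) (c' (Suc k)) = chain_map k ?\<nu> (c' k) + frag_cmul ((-1) ^ Suc k) (c' k)"
      if "k < n" for k
      unfolding c'_def
      using chain_boundary_singular_subdivision_power[OF ch[of "Suc k"], of m]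
        singular_subdivision_power_chain_map[OF ch[of k], of m ?\<nu>] bd[OF that] that
      by (simp add: singular_subdivision_power_add singular_subdivision_power_sign del: power_Suc)
  qed (use c0' s in auto)
  moreover have "chain_eval (\<lambda>f. cup s n (vertex f)) (c' n) = chain_eval (\<lambda>f. 0) (c' n)"
  proof (rule chain_eval_cong)
    fix f assume "f \<in> Poly_Mapping.keys (c' n)"
    then obtain V where V: "V \<in> W ` {..<n} \<union> W' ` {..<n}" "f \<in> standard_simplex n \<rightarrow> V"
      using m[of m f] by (auto simp: c'_def)
    have v: "vertex f j \<in> V" if "j \<le> n" for j
      using V(2) that by (force simp: vertex_def)
    obtain i where i: "i < n" "V = W i \<or> V = W' i" using V(1) by auto
    have "s i (vertex f i) = s i (vertex f (Suc i))"
      using v[of i] v[of "Suc i"] i by (auto simp: s_def W_def W'_def)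
    then have "s i (vertex f i) + s i (vertex f (Suc i)) = 0" by simp
    with i(1) show "cup s n (vertex f) = 0" unfolding cup_def
      by (intro prod_zero) auto
  qed
  ultimately show False by (simp add: chain_eval_def)
qed

section \<open>Disjoint faces of small total dimension\<close>

lemma card_int_set_le:
  fixes A :: "int set"
  assumes "\<And>x y. x \<in> A \<Longrightarrow> y \<in> A \<Longrightarrow> x \<le> y + int k"
  shows "card A \<le> k + 1"
proof (cases "finite A \<and> A \<noteq> {}")
  case True
  then have "A \<subseteq> {Min A..Min A + int k}"
    using assms Min_in by fastforce
  then have "card A \<le> card {Min A..Min A + int k}"
    by (rule card_mono[rotated]) simp
  then show ?thesis by simp
qed auto

definition floor_shift :: "(nat \<Rightarrow> real) \<Rightarrow> real \<Rightarrow> nat \<Rightarrow> int" where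
  "floor_shift y s = (\<lambda>j. \<lfloor>y j + s\<rfloor>)"

text \<open>As \<open>s\<close> grows, the point \<open>floor_shift y s\<close> runs through the vertices of the Kuhn simplex
  containing \<open>y\<close>; each coordinate jumps at most once per unit of \<open>s\<close>.\<close>

lemma card_floor_shift_le:
  assumes y: "\<And>j. j > n \<Longrightarrow> y j = 0" and S: "S \<subseteq> {0<..<1}" "\<And>a b c. a \<in> S \<Longrightarrow> c \<in> S \<Longrightarrow> a \<le> b \<Longrightarrow> b \<le> c \<Longrightarrow> b \<in> S"
    and A: "A \<subseteq> floor_shift y ` S"
  shows "card A \<le> card {j. j \<le> n \<and> (\<exists>s\<in>S. y j + s \<in> \<int>)} + 1"
proof -
  let ?J = "{j. j \<le> n \<and> (\<exists>s\<in>S. y j + s \<in> \<int>)}"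
  \<comment> \<open>The coordinate sum embeds the points in the integers: they increase with
    \<open>s\<close>, so equal sums force equal points, and the sum grows by at most the number of
    jumps.\<close>
  let ?T = "\<lambda>z. \<Sum>j\<le>n. z j :: int"
  have mono: "floor_shift y s j \<le> floor_shift y t j" if "s \<le> t" for s t j
    using that by (simp add: floor_shift_def floor_mono)
  have jump: "floor_shift y t j - floor_shift y s j \<le> of_bool (j \<in> ?J)"
    if "s \<in> S" "t \<in> S" "s \<le> t" "j \<le> n" for s t j
  proof (cases "floor_shift y t j = floor_shift y s j")
    case False
    then have l: "floor_shift y s j + 1 \<le> floor_shift y t j"
      using mono[OF that(3), of j] by linarith
    have "0 < s" "t < 1" using that(1,2) S(1) by auto
    then have "y j + t \<le> y j + s + 1" by linarith
    then have "floor_shift y t j \<le> floor_shift y s j + 1"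
      unfolding floor_shift_def by (metis floor_add_int floor_mono of_int_1)
    \<comment> \<open>The parameter at which \<open>y j + r\<close> reaches the new integer; it lies
      between \<open>s\<close> and \<open>t\<close>, hence in the order-convex set
      \<open>S\<close>.\<close>
    define r where "r = of_int (floor_shift y t j) - y j"
    have "s \<le> r" "r \<le> t"
      using l of_int_floor_le[of "y j + t"] floor_correct[of "y j + s"]
      unfolding r_def floor_shift_def by linarith+
    then have "r \<in> S" using S(2)[of s t r] that by simp
    moreover have "y j + r \<in> \<int>" by (simp add: r_def)
    ultimately have "j \<in> ?J" using that by blast
    then show ?thesis using \<open>floor_shift y t j \<le> floor_shift y s j + 1\<close> by auto
  qed auto
  have diff: "?T (floor_shift y t) \<le> ?T (floor_shift y s) + int (card ?J)"
    if "s \<in> S" "t \<in> S" for s t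
  proof (cases "s \<le> t")
    case True
    have "?T (floor_shift y t) - ?T (floor_shift y s)
        = (\<Sum>j\<le>n. floor_shift y t j - floor_shift y s j)"
      by (simp add: sum_subtractf)
    also have "\<dots> \<le> (\<Sum>j\<le>n. of_bool (j \<in> ?J))"
      by (rule sum_mono) (use jump[OF that True] in auto)
    also have "\<dots> = int (card ?J)"
      by (simp add: of_bool_def sum.If_cases Int_def)
    finally show ?thesis by simp
  next
    case False
    then have "?T (floor_shift y t) \<le> ?T (floor_shift y s)"
      by (intro sum_mono mono) auto
    then show ?thesis by linarith
  qed
  have eq: "floor_shift y s = floor_shift y t"
    if "s \<in> S" "t \<in> S" "s \<le> t" "?T (floor_shift y s) = ?T (floor_shift y t)" for s t
  proof
    fix j
    show "floor_shift y s j = floor_shift y t j"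
    proof (cases "j \<le> n")
      case True
      then show ?thesis
        using sum_mono_inv[of "floor_shift y s" "{..n}" "floor_shift y t" j] that(4) mono[OF that(3)]
        by auto
    next
      case False
      have "\<lfloor>s\<rfloor> = 0" "\<lfloor>t\<rfloor> = 0" using S(1) that(1,2) by (force simp: floor_eq_iff)+
      then show ?thesis using False y[of j] by (simp add: floor_shift_def)
    qed
  qed
  have "inj_on ?T A"
  proof (rule inj_onI)
    fix z z' assume z: "z \<in> A" "z' \<in> A" "?T z = ?T z'"
    then obtain s t where "s \<in> S" "t \<in> S" "z = floor_shift y s" "z' = floor_shift y t"
      using A by blast
    then show "z = z'" using eq[of s t] eq[of t s] z(3) by (cases "s \<le> t") auto
  qed
  then have "card A = card (?T ` A)"
    by (simp add: card_image)
  also have "\<dots> \<le> card ?J + 1"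
  proof (rule card_int_set_le)
    fix a b assume "a \<in> ?T ` A" "b \<in> ?T ` A"
    then obtain s t where "s \<in> S" "t \<in> S" "a = ?T (floor_shift y s)" "b = ?T (floor_shift y t)"
      using A by blast
    then show "a \<le> b + int (card ?J)" using diff[of t s] by simp
  qed
  finally show ?thesis .
qed

text \<open>The set of all \<open>s\<close> in \<open>(0, 1/2)\<close> with \<open>\<lfloor>y + s\<rfloor> = z\<close> has nonempty interior.\<close>

definition kuhn_near :: "nat \<Rightarrow> (nat \<Rightarrow> int) \<Rightarrow> (nat \<Rightarrow> real) \<Rightarrow> bool" where
  "kuhn_near n z y \<longleftrightarrow> (\<forall>i\<le>n. of_int (z i) - y i < 1 / 2 \<and> 0 < of_int (z i) - y i + 1
     \<and> (\<forall>j\<le>n. of_int (z i) - y i < of_int (z j) - y j + 1))"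

text \<open>For fixed \<open>j\<close>, the equation \<open>\<lfloor>y j + s\<rfloor> = z j\<close>
  confines \<open>s\<close> to an interval. The inequalities of \<open>kuhn_near\<close> put every
  lower bound, including 0, below every upper bound, including \<open>1/2\<close>, so all these
  intervals share an open piece.\<close>

lemma kuhn_near_interval:
  assumes "kuhn_near n z y"
  obtains a b where "0 \<le> a" "a < b" "b \<le> 1 / 2"
    "\<And>s j. a < s \<Longrightarrow> s < b \<Longrightarrow> j \<le> n \<Longrightarrow> \<lfloor>y j + s\<rfloor> = z j"
proof
  let ?A = "insert 0 ((\<lambda>i. of_int (z i) - y i) ` {..n})"
  let ?B = "insert (1/2) ((\<lambda>i. of_int (z i) - y i + 1) ` {..n})"
  show "0 \<le> Max ?A" "Min ?B \<le> 1 / 2" by auto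
  have "a < b" if "a \<in> ?A" "b \<in> ?B" for a b
    using that assms by (fastforce simp: kuhn_near_def)
  moreover have "Max ?A \<in> ?A" "Min ?B \<in> ?B"
    by (rule Max_in Min_in; simp)+
  ultimately show "Max ?A < Min ?B" by blast
  show "\<lfloor>y j + s\<rfloor> = z j" if "Max ?A < s" "s < Min ?B" "j \<le> n" for s j
  proof -
    have "of_int (z j) - y j < s" "s < of_int (z j) - y j + 1"
      using that by (auto simp: Max_less_iff Min_gr_iff)
    then show ?thesis by linarith
  qed
qed

text \<open>A sufficiently small positive \<open>s\<close> does not change any floor.\<close>

lemma kuhn_near_floor: "kuhn_near n (\<lambda>j. \<lfloor>y j\<rfloor>) y"
proof -
  have "of_int \<lfloor>y i\<rfloor> - y i \<le> 0" "0 < of_int \<lfloor>y i\<rfloor> - y i + 1" for i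
    by linarith+
  then show ?thesis unfolding kuhn_near_def by (smt (verit) half_gt_zero)
qed

lemma kuhn_near_imp_floor_shift:
  assumes "kuhn_near n z y" "\<And>j. j > n \<Longrightarrow> y j = 0" "\<And>j. j > n \<Longrightarrow> z j = 0"
  shows "z \<in> floor_shift y ` {0<..<1/2}"
proof -
  obtain a b where ab: "0 \<le> a" "a < b" "b \<le> 1 / 2"
    "\<And>s j. a < s \<Longrightarrow> s < b \<Longrightarrow> j \<le> n \<Longrightarrow> \<lfloor>y j + s\<rfloor> = z j"
    by (rule kuhn_near_interval[OF assms(1)]) (rule that)
  define s where "s = (a + b) / 2"
  have s: "a < s" "s < b" using ab(2) by (auto simp: s_def)
  have "floor_shift y s j = z j" for j
    using ab(1,3) ab(4)[OF s, of j] assms(2,3)[of j] s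
    by (cases "j \<le> n") (auto simp: floor_shift_def floor_eq_iff)
  then have "floor_shift y s = z" by blast
  then show ?thesis using ab s by (intro image_eqI[of _ _ s]) auto
qed

text \<open>Away from the jumps, \<open>\<lfloor>- y + s\<rfloor> = - \<lfloor>y + (1 - s)\<rfloor>\<close>: negation exchanges the two halves of the
  unit interval.\<close>

lemma kuhn_near_uminus_imp_floor_shift:
  assumes "kuhn_near n z (\<lambda>j. - y j)" "\<And>j. j > n \<Longrightarrow> y j = 0" "\<And>j. j > n \<Longrightarrow> z j = 0"
  shows "(\<lambda>j. - z j) \<in> floor_shift y ` {1/2<..<1}"
proof -
  obtain a b where ab: "0 \<le> a" "a < b" "b \<le> 1 / 2"
    "\<And>s j. a < s \<Longrightarrow> s < b \<Longrightarrow> j \<le> n \<Longrightarrow> \<lfloor>- y j + s\<rfloor> = z j"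
    by (rule kuhn_near_interval[OF assms(1)]) (rule that)
  \<comment> \<open>The second parameter \<open>t < s\<close> shows that \<open>- y j + s\<close> is
    strictly above \<open>z j\<close>, so that negation yields the floor \<open>- z j\<close>
    exactly.\<close>
  define s t where "s = (a + b) / 2" and "t = (a + s) / 2"
  have s: "a < s" "s < b" "a < t" "t < s" using ab(2) by (auto simp: s_def t_def)
  have "floor_shift y (1 - s) j = - z j" for j
  proof (cases "j \<le> n")
    case True
    have "\<lfloor>- y j + s\<rfloor> = z j" "\<lfloor>- y j + t\<rfloor> = z j"
      using ab(4) s True by auto
    then show ?thesis using s by (simp add: floor_shift_def floor_eq_iff)
  next
    case False
    then show ?thesis using ab(1,3) assms(2,3)[of j] s by (auto simp: floor_shift_def floor_eq_iff)
  qed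
  then have "floor_shift y (1 - s) = (\<lambda>j. - z j)" by blast
  then show ?thesis using ab s by (intro image_eqI[of _ _ "1 - s"]) auto
qed

text \<open>In one unit of the parameter a coordinate meets an integer only once, so it jumps in at
  most one of the two half intervals, and the integral coordinate \<open>j0\<close> jumps at 0, in
  neither. This leaves at most \<open>n\<close> jumps in all; each of the two sets of points has at
  most one more member than jumps.\<close>

lemma card_kuhn_near_le:
  assumes y: "\<And>j. j > n \<Longrightarrow> y j = 0" and B: "\<And>z j. z \<in> B \<Longrightarrow> j > n \<Longrightarrow> z j = 0"
    and j0: "j0 \<le> n" "y j0 \<in> \<int>"
  shows "card {z \<in> B. kuhn_near n z y} + card {z \<in> B. kuhn_near n z (\<lambda>j. - y j)} \<le> n + 2"
proof -
  define J where "J = (\<lambda>S. {j. j \<le> n \<and> (\<exists>s\<in>S. y j + s \<in> \<int>)})"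
  have 1: "card {z \<in> B. kuhn_near n z y} \<le> card (J {0<..<1/2}) + 1"
    unfolding J_def using y B by (intro card_floor_shift_le) (auto intro: kuhn_near_imp_floor_shift)
  have 2: "card {z \<in> B. kuhn_near n z (\<lambda>j. - y j)} \<le> card (J {1/2<..<1}) + 1"
  proof -
    have "inj_on (\<lambda>z j. - z j :: int) {z \<in> B. kuhn_near n z (\<lambda>j. - y j)}"
      by (auto simp: inj_on_def fun_eq_iff)
    then have "card {z \<in> B. kuhn_near n z (\<lambda>j. - y j)}
        = card ((\<lambda>z j. - z j) ` {z \<in> B. kuhn_near n z (\<lambda>j. - y j)})"
      by (simp add: card_image)
    also have "\<dots> \<le> card (J {1/2<..<1}) + 1"
      unfolding J_def using y B
      by (intro card_floor_shift_le) (auto intro!: kuhn_near_uminus_imp_floor_shift)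
    finally show ?thesis .
  qed
  have uniq: "s = t" if "y j + s \<in> \<int>" "y j + t \<in> \<int>" "s \<in> {0..<1}" "t \<in> {0..<1}" for j s t
  proof -
    have "(y j + s) - (y j + t) \<in> \<int>" using that by (intro Ints_diff)
    then obtain k where "s - t = of_int k" by (auto elim: Ints_cases)
    then have "k = 0" using that(3,4) by auto
    then show ?thesis using \<open>s - t = of_int k\<close> by simp
  qed
  have "J {0<..<1/2} \<inter> J {1/2<..<1} = {}"
    using uniq unfolding J_def by fastforce
  then have "card (J {0<..<1/2}) + card (J {1/2<..<1}) = card (J {0<..<1/2} \<union> J {1/2<..<1})"
    by (intro card_Un_disjoint[symmetric]) (auto simp: J_def)
  also have "\<dots> \<le> card ({..n} - {j0})"
  proof (rule card_mono)
    have "j0 \<notin> J {0<..<1/2}" "j0 \<notin> J {1/2<..<1}"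
      using uniq[of j0 0] j0 unfolding J_def by fastforce+
    then show "J {0<..<1/2} \<union> J {1/2<..<1} \<subseteq> {..n} - {j0}" by (auto simp: J_def)
  qed simp
  also have "\<dots> = n" using j0 by simp
  finally show ?thesis using 1 2 by linarith
qed

section \<open>The sup norm and the surface of a cube\<close>

lemma continuous_on_coordinate [continuous_intros]:
  "continuous_on S (\<lambda>x. x i :: 'b::topological_space)"
  by (rule continuous_on_subset[OF continuous_on_product_coordinates]) simp

primrec sup_norm :: "nat \<Rightarrow> (nat \<Rightarrow> real) \<Rightarrow> real" where
  "sup_norm 0 x = \<bar>x 0\<bar>"
| "sup_norm (Suc n) x = max (sup_norm n x) \<bar>x (Suc n)\<bar>"

lemma sup_norm_le_iff: "sup_norm n x \<le> r \<longleftrightarrow> (\<forall>j\<le>n. \<bar>x j\<bar> \<le> r)"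
  by (induction n) (auto simp: le_Suc_eq)

lemma abs_le_sup_norm: "j \<le> n \<Longrightarrow> \<bar>x j\<bar> \<le> sup_norm n x"
  using sup_norm_le_iff[of n x "sup_norm n x"] by auto

lemma sup_norm_attained: "\<exists>j\<le>n. \<bar>x j\<bar> = sup_norm n x"
  by (induction n) (auto simp: max_def le_Suc_eq)

lemma sup_norm_uminus [simp]: "sup_norm n (\<lambda>j. - x j) = sup_norm n x"
  by (induction n) auto

lemma sup_norm_scale: "0 \<le> c \<Longrightarrow> sup_norm n (\<lambda>j. c * x j) = c * sup_norm n x"
  by (induction n) (auto simp: abs_mult max_mult_distrib_left)

lemma continuous_on_sup_norm: "continuous_on S (sup_norm n)"
proof (induction n)
  case 0
  have "sup_norm 0 = (\<lambda>x. \<bar>x 0\<bar>)" by auto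
  then show ?case by (auto intro!: continuous_intros)
next
  case (Suc n)
  have "sup_norm (Suc n) = (\<lambda>x. max (sup_norm n x) \<bar>x (Suc n)\<bar>)" by auto
  then show ?case using Suc by (auto intro!: continuous_intros)
qed

text \<open>Coordinates beyond \<open>n\<close> vanish, as for \<open>nsphere\<close>. A cube is
  used because for a natural number \<open>r\<close> taking floors keeps a point on the
  surface.\<close>

definition cube_surface :: "nat \<Rightarrow> real \<Rightarrow> (nat \<Rightarrow> real) set" where
  "cube_surface n r = {y. (\<forall>j>n. y j = 0) \<and> sup_norm n y = r}"

lemma cube_surface_uminus: "y \<in> cube_surface n r \<Longrightarrow> (\<lambda>j. - y j) \<in> cube_surface n r"
  by (simp add: cube_surface_def)

lemma cube_surface_scale: "y \<in> cube_surface n r \<Longrightarrow> 0 \<le> c \<Longrightarrow> (\<lambda>j. c * y j) \<in> cube_surface n (c * r)"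
  by (simp add: cube_surface_def sup_norm_scale)

lemma compact_cube_surface: "compact (cube_surface n r)"
proof -
  have "closed (cube_surface n r)"
    unfolding cube_surface_def Collect_conj_eq
    by (intro closed_Int closed_Collect_all closed_Collect_imp closed_Collect_eq)
      (auto intro!: continuous_intros continuous_on_sup_norm)
  moreover have "cube_surface n r \<subseteq> (\<Pi>\<^sub>E j\<in>UNIV. {-\<bar>r\<bar>..\<bar>r\<bar>})"
  proof -
    have "\<bar>y j\<bar> \<le> \<bar>r\<bar>" if "y \<in> cube_surface n r" for y j
      using that abs_le_sup_norm[of j n y] by (cases "j \<le> n") (auto simp: cube_surface_def)
    then show ?thesis by (auto simp: abs_le_iff minus_le_iff)
  qed
  moreover have "compact (\<Pi>\<^sub>E j\<in>(UNIV::nat set). {-\<bar>r\<bar>..\<bar>r\<bar>})"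
  proof -
    have "compactin (powertop_real UNIV) (\<Pi>\<^sub>E j\<in>(UNIV::nat set). {-\<bar>r\<bar>..\<bar>r\<bar>})"
      by (simp add: compactin_PiE)
    then show ?thesis by (simp add: euclidean_product_topology)
  qed
  ultimately show ?thesis by (metis compact_Int_closed inf.absorb_iff2)
qed

text \<open>The metric on sequences is a geometrically weighted series; this bound turns
  coordinatewise closeness into the form used by uniform continuity.\<close>

lemma dist_fun_le:
  fixes x y :: "nat \<Rightarrow> real"
  assumes "\<And>j. \<bar>x j - y j\<bar> \<le> e"
  shows "dist x y \<le> 2 * e"
proof -
  have g: "(\<lambda>k. (1/2) ^ k * e) sums (2 * e)"
    using sums_mult2[OF geometric_sums[of "1/2::real"], of e] by simp
  have "dist x y = suminf (\<lambda>k. (1/2) ^ k * min (dist (x (from_nat k)) (y (from_nat k))) 1)"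
    by (simp add: dist_fun_def)
  also have "\<dots> \<le> suminf (\<lambda>k. (1/2) ^ k * e)"
  proof (rule suminf_le)
    show "(1/2) ^ k * min (dist (x (from_nat k)) (y (from_nat k))) 1 \<le> (1/2) ^ k * e" for k
      using assms[of "from_nat k"] by (intro mult_left_mono) (auto simp: dist_real_def)
    show "summable (\<lambda>k. (1/2) ^ k * min (dist (x (from_nat k)) (y (from_nat k))) 1)"
    proof (rule summable_comparison_test')
      show "summable (\<lambda>k. (1/2::real) ^ k)" by (simp add: summable_geometric)
    qed (auto simp: mult_left_le)
  qed (use g in \<open>auto simp: sums_iff\<close>)
  also have "\<dots> = 2 * e" using g by (simp add: sums_iff)
  finally show ?thesis .
qed

text \<open>Positive exactly when \<open>kuhn_near n z y\<close> holds; it serves in place of the length of the set of \<open>s\<close>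
  in \<open>(0, 1/2)\<close> with \<open>\<lfloor>y + s\<rfloor> = z\<close> because its continuity is immediate.\<close>

definition weight :: "nat \<Rightarrow> (nat \<Rightarrow> int) \<Rightarrow> (nat \<Rightarrow> real) \<Rightarrow> real" where
  "weight n z y = (\<Prod>i\<le>n. max 0 (1/2 - (of_int (z i) - y i)) * max 0 (of_int (z i) - y i + 1)
     * (\<Prod>j\<le>n. max 0 (of_int (z j) - y j + 1 - (of_int (z i) - y i))))"

lemma weight_nonneg: "0 \<le> weight n z y"
  unfolding weight_def by (intro prod_nonneg mult_nonneg_nonneg ballI) auto

lemma weight_pos_iff: "0 < weight n z y \<longleftrightarrow> kuhn_near n z y"
proof -
  have m: "max 0 t = 0 \<longleftrightarrow> t \<le> 0" for t :: real by auto
  have "weight n z y \<noteq> 0 \<longleftrightarrow> kuhn_near n z y"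
    unfolding weight_def kuhn_near_def by (simp add: m not_le) (auto simp: algebra_simps)
  then show ?thesis using weight_nonneg[of n z y] by auto
qed

lemma continuous_on_weight: "continuous_on S (weight n z)"
  unfolding weight_def by (intro continuous_intros) auto

text \<open>These are the barycentric coordinates obtained by pushing the normalised weights forward
  along \<open>\<psi>\<close>.\<close>

lemma weighted_geom_simplex:
  assumes "finite L" "\<And>z. z \<in> L \<Longrightarrow> 0 \<le> h z" "0 < sum h L"
  shows "(\<lambda>v. (\<Sum>z\<in>{z\<in>L. \<psi> z = v}. h z) / sum h L) \<in> geom_simplex (\<psi> ` {z\<in>L. 0 < h z})"
proof -
  let ?A = "{z\<in>L. 0 < h z}"
  have "(\<Sum>v\<in>\<psi> ` ?A. \<Sum>z\<in>{z\<in>L. \<psi> z = v}. h z) = (\<Sum>v\<in>\<psi> ` ?A. \<Sum>z\<in>{z\<in>?A. \<psi> z = v}. h z)"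
    using assms by (intro sum.cong sum.mono_neutral_right refl) (auto simp: order_le_less)
  also have "\<dots> = sum h ?A"
    using assms by (intro sum.group) auto
  also have "\<dots> = sum h L"
    using assms by (intro sum.mono_neutral_left) (auto simp: order_le_less)
  finally have "(\<Sum>v\<in>\<psi> ` ?A. (\<Sum>z\<in>{z\<in>L. \<psi> z = v}. h z) / sum h L) = 1"
    using assms by (simp flip: sum_divide_distrib)
  moreover have "(\<Sum>z\<in>{z\<in>L. \<psi> z = v}. h z) = 0" if "v \<notin> \<psi> ` ?A" for v
    using assms that by (intro sum.neutral) (force simp: order_le_less)
  moreover have "0 \<le> (\<Sum>z\<in>{z\<in>L. \<psi> z = v}. h z) / sum h L" for v
    using assms by (intro divide_nonneg_nonneg sum_nonneg) auto
  ultimately show ?thesis by (simp add: geom_simplex_def)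
qed

section \<open>Lattice points on the cube surface\<close>

definition cube_lattice :: "nat \<Rightarrow> nat \<Rightarrow> (nat \<Rightarrow> int) set" where
  "cube_lattice n N = {z. (\<lambda>j. of_int (z j)) \<in> cube_surface n (real N)}"

lemma cube_lattice_zero: "z \<in> cube_lattice n N \<Longrightarrow> j > n \<Longrightarrow> z j = 0"
  by (simp add: cube_lattice_def cube_surface_def)

lemma finite_cube_lattice: "finite (cube_lattice n N)"
proof (rule finite_subset)
  show "cube_lattice n N \<subseteq> {z. \<forall>j. (j \<in> {..n} \<longrightarrow> z j \<in> {- int N..int N}) \<and> (j \<notin> {..n} \<longrightarrow> z j = 0)}"
  proof clarify
    fix z j assume z: "z \<in> cube_lattice n N"
    have "\<bar>of_int (z j)\<bar> \<le> real N" if "j \<le> n"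
      using z abs_le_sup_norm[of j n "\<lambda>j. of_int (z j)"] that by (simp add: cube_lattice_def cube_surface_def)
    then have "z j \<in> {- int N..int N}" if "j \<le> n"
      using that by auto
    then show "(j \<in> {..n} \<longrightarrow> z j \<in> {- int N..int N}) \<and> (j \<notin> {..n} \<longrightarrow> z j = 0)"
      using cube_lattice_zero[OF z, of j] by auto
  qed
qed (rule finite_set_of_finite_funs; simp)

text \<open>A coordinate of absolute value \<open>N\<close> is an integer and is fixed by the floor;
  the other floors stay between the integers \<open>-N\<close> and \<open>N\<close>.\<close>

lemma floor_in_cube_lattice:
  assumes y: "y \<in> cube_surface n (real N)"
  shows "(\<lambda>j. \<lfloor>y j\<rfloor>) \<in> cube_lattice n N"
proof -
  have s: "sup_norm n y = real N" and z: "\<And>j. j > n \<Longrightarrow> y j = 0" using y by (auto simp: cube_surface_def)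
  have "\<bar>of_int \<lfloor>y j\<rfloor>\<bar> \<le> real N" if "j \<le> n" for j
  proof -
    have "\<bar>y j\<bar> \<le> real N" using abs_le_sup_norm[OF that, of y] s by simp
    then have "- int N \<le> \<lfloor>y j\<rfloor>" "\<lfloor>y j\<rfloor> \<le> int N" by linarith+
    then show ?thesis by linarith
  qed
  then have "sup_norm n (\<lambda>j. of_int \<lfloor>y j\<rfloor>) \<le> real N" by (simp add: sup_norm_le_iff)
  moreover obtain j where j: "j \<le> n" "\<bar>y j\<bar> = real N" using sup_norm_attained[of n y] s by auto
  then have "y j = of_int (int N) \<or> y j = of_int (- int N)" by (auto simp: abs_if split: if_splits)
  then have "\<bar>of_int \<lfloor>y j\<rfloor>\<bar> = real N" by (metis floor_of_int j(2))
  then have "real N \<le> sup_norm n (\<lambda>j. of_int \<lfloor>y j\<rfloor>)"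
    using abs_le_sup_norm[OF j(1), of "\<lambda>j. of_int \<lfloor>y j\<rfloor>"] by simp
  ultimately show ?thesis using z by (simp add: cube_lattice_def cube_surface_def)
qed

lemma cube_surface_int_coordinate:
  assumes "y \<in> cube_surface n (real N)"
  obtains j where "j \<le> n" "y j \<in> \<int>"
proof -
  obtain j where "j \<le> n" "\<bar>y j\<bar> = real N"
    using sup_norm_attained[of n y] assms by (auto simp: cube_surface_def)
  then have "j \<le> n" "y j = of_int (int N) \<or> y j = of_int (- int N)"
    by (auto simp: abs_if split: if_splits)
  then show ?thesis using that by (metis Ints_of_int)
qed

lemma kuhn_near_abs_le: "kuhn_near n z y \<Longrightarrow> j \<le> n \<Longrightarrow> \<bar>of_int (z j) - y j\<bar> \<le> 1"
  unfolding kuhn_near_def by (smt (verit) field_sum_of_halves)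

text \<open>On the compact cube surface the sum of the positive parts attains a positive minimum,
  and some term carries its share of it. The \<open>+ 1\<close> in \<open>c\<close> makes the
  comparison strict.\<close>

lemma uniform_lower_bound:
  fixes w :: "(nat \<Rightarrow> real) \<Rightarrow> 'a \<Rightarrow> real"
  assumes V: "finite V" and cont: "\<And>v. continuous_on (cube_surface n 1) (\<lambda>u. w u v)"
    and pos: "\<And>u. u \<in> cube_surface n 1 \<Longrightarrow> \<exists>v\<in>V. 0 < w u v"
  obtains c where "0 < c" "\<And>u. u \<in> cube_surface n 1 \<Longrightarrow> \<exists>v\<in>V. c \<le> w u v"
proof -
  define g where "g = (\<lambda>u. \<Sum>v\<in>V. max 0 (w u v))"
  have gpos: "0 < g u" if "u \<in> cube_surface n 1" for u
    using pos[OF that] V unfolding g_def by (force intro: sum_pos2)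
  have "(\<lambda>j. if j = 0 then 1 else 0) \<in> cube_surface n 1"
  proof -
    have "sup_norm n (\<lambda>j. if j = 0 then 1 else 0) = 1" by (induction n) auto
    then show ?thesis by (auto simp: cube_surface_def)
  qed
  then have "cube_surface n 1 \<noteq> {}" by blast
  moreover have "continuous_on (cube_surface n 1) g"
    unfolding g_def by (intro continuous_intros cont)
  ultimately obtain a where a: "a \<in> cube_surface n 1" "\<And>u. u \<in> cube_surface n 1 \<Longrightarrow> g a \<le> g u"
    using continuous_attains_inf[OF compact_cube_surface] by blast
  define c where "c = g a / (card V + 1)"
  have c: "0 < c" using gpos[OF a(1)] by (simp add: c_def)
  have "\<exists>v\<in>V. c \<le> w u v" if u: "u \<in> cube_surface n 1" for u
  proof (rule ccontr)
    assume "\<not> ?thesis"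
    then have "max 0 (w u v) \<le> c" if "v \<in> V" for v using that c by force
    then have "g u \<le> (\<Sum>v\<in>V. c)" unfolding g_def by (rule sum_mono)
    also have "\<dots> < c * (card V + 1)" using c by (simp add: algebra_simps)
    also have "\<dots> = g a" by (simp add: c_def)
    finally show False using a(2)[OF u] by simp
  qed
  with c show ?thesis using that by blast
qed

lemma uniform_mesh:
  fixes w :: "(nat \<Rightarrow> real) \<Rightarrow> 'a \<Rightarrow> real"
  assumes V: "finite V" and cont: "\<And>v. continuous_on (cube_surface n 1) (\<lambda>u. w u v)" and c: "0 < c"
  obtains N :: nat where "0 < N"
    "\<And>u u' v. u \<in> cube_surface n 1 \<Longrightarrow> u' \<in> cube_surface n 1 \<Longrightarrow> v \<in> V \<Longrightarrow> (\<And>j. j \<le> n \<Longrightarrow> \<bar>u j - u' j\<bar> \<le> 1 / real N)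
      \<Longrightarrow> \<bar>w u v - w u' v\<bar> < c"
proof -
  define P where "P = (\<lambda>v N. \<forall>u\<in>cube_surface n 1. \<forall>u'\<in>cube_surface n 1. (\<forall>j\<le>n. \<bar>u j - u' j\<bar> \<le> 1 / real N)
      \<longrightarrow> \<bar>w u v - w u' v\<bar> < c)"
  have "eventually (P v) sequentially" for v
  proof -
    have "uniformly_continuous_on (cube_surface n 1) (\<lambda>u. w u v)"
      using compact_uniformly_continuous cont compact_cube_surface by blast
    then obtain d where d: "0 < d" "\<And>u u'. u \<in> cube_surface n 1 \<Longrightarrow> u' \<in> cube_surface n 1 \<Longrightarrow> dist u' u < d
        \<Longrightarrow> dist (w u' v) (w u v) < c"
      unfolding uniformly_continuous_on_def using c by metis
    \<comment> \<open>The factor 2 comes from \<open>dist_fun_le\<close>.\<close>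
    have "(\<lambda>N. 2 * (1 / real N)) \<longlonglongrightarrow> 2 * 0"
      by (intro tendsto_intros lim_1_over_n)
    then have "eventually (\<lambda>N. 2 * (1 / real N) < d) sequentially"
      using d(1) by (intro order_tendstoD) auto
    then show ?thesis
    proof eventually_elim
      case (elim N)
      show ?case unfolding P_def
      proof (intro ballI impI)
        fix u u' assume u: "u \<in> cube_surface n 1" "u' \<in> cube_surface n 1" "\<forall>j\<le>n. \<bar>u j - u' j\<bar> \<le> 1 / real N"
        have "\<bar>u j - u' j\<bar> \<le> 1 / real N" for j
          using u by (cases "j \<le> n") (auto simp: cube_surface_def)
        then have "dist u u' \<le> 2 * (1 / real N)" by (rule dist_fun_le)
        then have "dist (w u v) (w u' v) < c" using elim d(2) u by simp
        then show "\<bar>w u v - w u' v\<bar> < c" by (simp add: dist_real_def)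
      qed
    qed
  qed
  then have "eventually (\<lambda>N. \<forall>v\<in>V. P v N) sequentially"
    using V by (simp add: eventually_ball_finite)
  then have "eventually (\<lambda>N. 0 < N \<and> (\<forall>v\<in>V. P v N)) sequentially"
    using eventually_gt_at_top[of 0] by eventually_elim auto
  then obtain N where "0 < N" "\<forall>v\<in>V. P v N"
    using eventually_happens trivial_limit_sequentially by blast
  then show ?thesis using that[of N] unfolding P_def by blast
qed

text \<open>At the label of a lattice point near \<open>u\<close> the function \<open>w u\<close> is
  positive, so the label is a vertex of every face whose simplex contains \<open>\<phi> u\<close>;
  at the labels near \<open>-u\<close> it is negative. The two label sets are therefore disjoint
  faces, and \<open>card_kuhn_near_le\<close> bounds their total size.\<close>

lemma disjoint_faces_map:
  fixes \<phi> :: "(nat \<Rightarrow> real) \<Rightarrow> 'a \<Rightarrow> real"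
  assumes K: "simplicial_complex K"
    and im: "\<And>u. u \<in> cube_surface n 1 \<Longrightarrow> \<phi> u \<in> (\<Union>\<sigma>\<in>K. geom_simplex \<sigma>)"
    and neq: "\<And>u. u \<in> cube_surface n 1 \<Longrightarrow> \<phi> (\<lambda>j. - u j) \<noteq> \<phi> u"
    and cont: "\<And>v. continuous_on (cube_surface n 1) (\<lambda>u. \<phi> u v)"
  obtains p where "\<And>v. continuous_on (cube_surface n 1) (\<lambda>u. p u v)"
    "\<And>u. u \<in> cube_surface n 1 \<Longrightarrow> \<exists>\<sigma>\<in>K. \<exists>\<sigma>'\<in>K. \<sigma> \<inter> \<sigma>' = {} \<and> card \<sigma> + card \<sigma>' \<le> n + 2
        \<and> p u \<in> geom_simplex \<sigma> \<and> p (\<lambda>j. - u j) \<in> geom_simplex \<sigma>'"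
proof -
  let ?C = "cube_surface n 1"
  define V where "V = \<Union>K"
  have V: "finite V" using K by (auto simp: V_def simplicial_complex_def)
  define w where "w = (\<lambda>u v. \<phi> u v - \<phi> (\<lambda>j. - u j) v)"
  have w_uminus: "w (\<lambda>j. - u j) v = - w u v" for u v by (simp add: w_def)
  have \<phi>V: "sum (\<phi> u) V = 1" "v \<notin> V \<Longrightarrow> \<phi> u v = 0" "0 \<le> \<phi> u v" if u: "u \<in> ?C" for u v
  proof -
    obtain \<sigma> where \<sigma>: "\<sigma> \<in> K" "\<phi> u \<in> geom_simplex \<sigma>" using im[OF u] by blast
    have "sum (\<phi> u) V = sum (\<phi> u) \<sigma>"
      using \<sigma> V by (intro sum.mono_neutral_right) (auto simp: V_def geom_simplex_def)
    then show "sum (\<phi> u) V = 1" "v \<notin> V \<Longrightarrow> \<phi> u v = 0" "0 \<le> \<phi> u v"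
      using \<sigma> by (auto simp: geom_simplex_def V_def)
  qed
  \<comment> \<open>Both coordinate sums are 1, so \<open>w u\<close> cannot be nonpositive
    everywhere without vanishing.\<close>
  have pos: "\<exists>v\<in>V. 0 < w u v" if u: "u \<in> ?C" for u
  proof (rule ccontr)
    assume "\<not> ?thesis"
    then have le: "\<And>v. v \<in> V \<Longrightarrow> \<phi> u v \<le> \<phi> (\<lambda>j. - u j) v" by (force simp: w_def)
    have "\<phi> u v = \<phi> (\<lambda>j. - u j) v" for v
    proof (cases "v \<in> V")
      case True
      then show ?thesis
        using sum_mono_inv[of "\<phi> u" V "\<phi> (\<lambda>j. - u j)" v] le V \<phi>V(1)[OF u] \<phi>V(1)[OF cube_surface_uminus[OF u]]
        by simp
    qed (use \<phi>V(2)[OF u] \<phi>V(2)[OF cube_surface_uminus[OF u]] in simp)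
    then show False using neq[OF u] by auto
  qed
  have contw: "continuous_on ?C (\<lambda>u. w u v)" for v
  proof -
    have "continuous_on ?C (\<lambda>u. \<phi> (\<lambda>j. - u j) v)"
      by (rule continuous_on_compose2[OF cont])
        (auto intro!: continuous_intros continuous_on_coordinatewise_then_product cube_surface_uminus)
    then show ?thesis unfolding w_def by (intro continuous_intros cont)
  qed
  obtain c where c: "0 < c" "\<And>u. u \<in> ?C \<Longrightarrow> \<exists>v\<in>V. c \<le> w u v"
    using uniform_lower_bound[where w = w, OF V contw pos] by metis
  obtain N :: nat where N: "0 < N"
    "\<And>u u' v. u \<in> ?C \<Longrightarrow> u' \<in> ?C \<Longrightarrow> v \<in> V \<Longrightarrow> (\<And>j. j \<le> n \<Longrightarrow> \<bar>u j - u' j\<bar> \<le> 1 / real N)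
      \<Longrightarrow> \<bar>w u v - w u' v\<bar> < c"
    using uniform_mesh[where w = w, OF V contw c(1)] by metis
  define L where "L = cube_lattice n N"
  have L: "finite L" by (simp add: L_def finite_cube_lattice)
  define r where "r = (\<lambda>z::nat \<Rightarrow> int. \<lambda>j. (1 / real N) * of_int (z j))"
  have r: "r z \<in> ?C" if "z \<in> L" for z
    using that cube_surface_scale[of "\<lambda>j. of_int (z j)" n "real N" "1 / real N"] N(1)
    by (simp add: r_def L_def cube_lattice_def)
  define \<psi> where "\<psi> = (\<lambda>z. SOME v. v \<in> V \<and> c \<le> w (r z) v)"
  have \<psi>: "\<psi> z \<in> V" "c \<le> w (r z) (\<psi> z)" if "z \<in> L" for z
    using someI_ex[of "\<lambda>v. v \<in> V \<and> c \<le> w (r z) v"] c(2)[OF r[OF that]] unfolding \<psi>_def by blast+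
  define Y where "Y = (\<lambda>(u::nat \<Rightarrow> real) j. real N * u j)"
  have Y: "Y u \<in> cube_surface n (real N)" if "u \<in> ?C" for u
    using cube_surface_scale[OF that, of "real N"] by (simp add: Y_def)
  have Yneg: "Y (\<lambda>j. - u j) = (\<lambda>j. - Y u j)" for u by (simp add: Y_def)
  \<comment> \<open>The label was chosen with \<open>w\<close> at least \<open>c\<close> at the
    lattice point, and within one mesh width \<open>w\<close> changes by less than
    \<open>c\<close>.\<close>
  have \<psi>pos: "0 < w u (\<psi> z)" if u: "u \<in> ?C" and z: "z \<in> L" "kuhn_near n z (Y u)" for u z
  proof -
    have "\<bar>r z j - u j\<bar> \<le> 1 / real N" if "j \<le> n" for j
    proof -
      have "r z j - u j = (of_int (z j) - Y u j) / real N"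
        using N(1) by (simp add: r_def Y_def field_simps)
      then have "\<bar>r z j - u j\<bar> = \<bar>of_int (z j) - Y u j\<bar> / real N"
        by (simp add: abs_divide)
      also have "\<dots> \<le> 1 / real N"
        using kuhn_near_abs_le[OF z(2) that] by (intro divide_right_mono) auto
      finally show ?thesis .
    qed
    then have "\<bar>w (r z) (\<psi> z) - w u (\<psi> z)\<bar> < c"
      using N(2) r u \<psi>(1) z(1) by blast
    then show ?thesis using \<psi>(2)[OF z(1)] by linarith
  qed
  define p where "p = (\<lambda>u v. (\<Sum>z\<in>{z\<in>L. \<psi> z = v}. weight n z (Y u)) / (\<Sum>z\<in>L. weight n z (Y u)))"
  define A where "A = (\<lambda>u. {z\<in>L. kuhn_near n z (Y u)})"
  have sum_pos: "0 < (\<Sum>z\<in>L. weight n z (Y u))" if "u \<in> ?C" for u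
  proof (rule sum_pos2[OF L])
    show "(\<lambda>j. \<lfloor>Y u j\<rfloor>) \<in> L" using floor_in_cube_lattice[OF Y[OF that]] by (simp add: L_def)
    show "0 < weight n (\<lambda>j. \<lfloor>Y u j\<rfloor>) (Y u)" by (simp add: weight_pos_iff kuhn_near_floor)
  qed (simp add: weight_nonneg)
  have pA: "p u \<in> geom_simplex (\<psi> ` A u)" if "u \<in> ?C" for u
    using weighted_geom_simplex[OF L, of "\<lambda>z. weight n z (Y u)" \<psi>] sum_pos[OF that]
    by (simp add: p_def A_def weight_nonneg weight_pos_iff)
  have AK: "\<psi> ` A u \<in> K" if u: "u \<in> ?C" for u
  proof -
    obtain \<sigma> where \<sigma>: "\<sigma> \<in> K" "\<phi> u \<in> geom_simplex \<sigma>" using im[OF u] by blast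
    have "\<psi> ` A u \<subseteq> \<sigma>"
    proof clarify
      fix z assume "z \<in> A u"
      then have "0 < w u (\<psi> z)" using \<psi>pos u by (auto simp: A_def)
      moreover have "0 \<le> \<phi> (\<lambda>j. - u j) (\<psi> z)" using \<phi>V(3) cube_surface_uminus u by blast
      ultimately have "\<phi> u (\<psi> z) \<noteq> 0" by (simp add: w_def)
      then show "\<psi> z \<in> \<sigma>" using \<sigma> by (auto simp: geom_simplex_def)
    qed
    moreover have "\<psi> ` A u \<noteq> {}"
      using floor_in_cube_lattice[OF Y[OF u]] kuhn_near_floor by (auto simp: A_def L_def)
    ultimately show ?thesis using K \<sigma>(1) unfolding simplicial_complex_def by blast
  qed
  show ?thesis
  proof
    have contY: "continuous_on ?C (\<lambda>u. weight n z (Y u))" for z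
      by (rule continuous_on_compose2[OF continuous_on_weight[of UNIV]])
        (auto simp: Y_def intro!: continuous_intros continuous_on_coordinatewise_then_product)
    show "continuous_on ?C (\<lambda>u. p u v)" for v
      unfolding p_def
      by (intro continuous_on_divide continuous_on_sum contY) (use sum_pos in force)
    fix u assume u: "u \<in> ?C"
    let ?u = "\<lambda>j. - u j"
    have u': "?u \<in> ?C" using cube_surface_uminus[OF u] .
    have "\<psi> ` A u \<inter> \<psi> ` A ?u = {}"
    proof -
      have "\<psi> z \<noteq> \<psi> z'" if "z \<in> A u" "z' \<in> A ?u" for z z'
        using \<psi>pos[OF u, of z] \<psi>pos[OF u', of z'] that w_uminus[of u "\<psi> z'"] by (auto simp: A_def)
      then show ?thesis by blast
    qed
    moreover have "card (\<psi> ` A u) + card (\<psi> ` A ?u) \<le> n + 2"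
    proof -
      \<comment> \<open>The integral coordinate lowers the bound from \<open>n + 3\<close> to
        \<open>n + 2\<close>.\<close>
      obtain j where j: "j \<le> n" "Y u j \<in> \<int>" using cube_surface_int_coordinate[OF Y[OF u]] .
      have "card (A u) + card (A ?u) \<le> n + 2"
        unfolding A_def Yneg
        using card_kuhn_near_le[of n "Y u" L j] j cube_lattice_zero Y[OF u] by (auto simp: L_def cube_surface_def)
      moreover have "card (\<psi> ` A u) \<le> card (A u)" "card (\<psi> ` A ?u) \<le> card (A ?u)"
        using L by (auto intro: card_image_le simp: A_def)
      ultimately show ?thesis by linarith
    qed
    ultimately show "\<exists>\<sigma>\<in>K. \<exists>\<sigma>'\<in>K. \<sigma> \<inter> \<sigma>' = {} \<and> card \<sigma> + card \<sigma>' \<le> n + 2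
        \<and> p u \<in> geom_simplex \<sigma> \<and> p ?u \<in> geom_simplex \<sigma>'"
      using pA[OF u] pA[OF u'] AK[OF u] AK[OF u'] by blast
  qed
qed

section \<open>Extending a map from the skeleton\<close>

abbreviation polyhedron :: "'a set set \<Rightarrow> ('a \<Rightarrow> real) set" where
  "polyhedron K \<equiv> \<Union>\<sigma>\<in>K. geom_simplex \<sigma>"

section \<open>Compactness of polyhedra\<close>

lemma realization_eq: "realization K = top_of_set (polyhedron K)"
  by (simp add: realization_def euclidean_product_topology)

lemma simplicial_complex_finite: "simplicial_complex K \<Longrightarrow> \<sigma> \<in> K \<Longrightarrow> finite \<sigma>"
  by (simp add: simplicial_complex_def)

lemma simplicial_complex_face:
  "simplicial_complex K \<Longrightarrow> \<sigma> \<in> K \<Longrightarrow> \<tau> \<subseteq> \<sigma> \<Longrightarrow> \<tau> \<noteq> {} \<Longrightarrow> \<tau> \<in> K"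
  unfolding simplicial_complex_def by metis

lemma closed_geom_simplex: "closed (geom_simplex \<sigma>)"
  unfolding geom_simplex_def Collect_conj_eq
  by (intro closed_Int closed_Collect_all closed_Collect_imp closed_Collect_eq closed_Collect_le)
    (auto intro!: continuous_intros)

lemma compact_geom_simplex:
  fixes \<sigma> :: "'a set"
  assumes "finite \<sigma>"
  shows "compact (geom_simplex \<sigma>)"
proof -
  have "geom_simplex \<sigma> \<subseteq> (\<Pi>\<^sub>E v\<in>UNIV. {0..1})"
  proof -
    have "x v \<le> 1" if "x \<in> geom_simplex \<sigma>" for x v
      using that assms member_le_sum[of v \<sigma> x] by (cases "v \<in> \<sigma>") (auto simp: geom_simplex_def)
    then show ?thesis by (auto simp: geom_simplex_def)
  qed
  moreover have "compact (\<Pi>\<^sub>E v\<in>(UNIV::'a set). {0..1::real})"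
  proof -
    have "compactin (powertop_real UNIV) (\<Pi>\<^sub>E v\<in>(UNIV::'a set). {0..1::real})"
      by (simp add: compactin_PiE)
    then show ?thesis by (simp add: euclidean_product_topology)
  qed
  ultimately show ?thesis by (metis closed_geom_simplex compact_Int_closed inf.absorb_iff2)
qed

lemma closed_polyhedron: "simplicial_complex K \<Longrightarrow> closed (polyhedron K)"
  by (auto simp: simplicial_complex_def intro!: closed_UN closed_geom_simplex)

lemma compact_polyhedron: "simplicial_complex K \<Longrightarrow> compact (polyhedron K)"
  by (auto simp: simplicial_complex_def intro!: compact_UN compact_geom_simplex)

lemma simplicial_complex_skeleton: "simplicial_complex K \<Longrightarrow> simplicial_complex (skeleton d K)"
  unfolding simplicial_complex_def skeleton_def
  by (auto intro: order_trans[OF card_mono])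

text \<open>Vanishes on the d-skeleton and is positive on the rest of the polyhedron: a product over
  \<open>d + 2\<close> vertices is nonzero exactly when the support of the point contains them
  all.\<close>

definition off_skeleton :: "nat \<Rightarrow> 'a set set \<Rightarrow> ('a \<Rightarrow> real) \<Rightarrow> real" where
  "off_skeleton d K x = (\<Sum>\<sigma> | \<sigma> \<in> K \<and> card \<sigma> = d + 2. \<Prod>v\<in>\<sigma>. x v)"

lemma off_skeleton_eq_0:
  assumes K: "simplicial_complex K" and x: "x \<in> polyhedron (skeleton d K)"
  shows "off_skeleton d K x = 0"
  unfolding off_skeleton_def
proof (rule sum.neutral, clarify)
  fix \<sigma> assume \<sigma>: "\<sigma> \<in> K" "card \<sigma> = d + 2"
  obtain \<tau> where \<tau>: "\<tau> \<in> K" "card \<tau> \<le> d + 1" "x \<in> geom_simplex \<tau>"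
    using x by (auto simp: skeleton_def)
  have "\<not> \<sigma> \<subseteq> \<tau>" using card_mono[of \<tau> \<sigma>] \<sigma>(2) \<tau>(2) simplicial_complex_finite[OF K \<tau>(1)] by linarith
  then obtain v where "v \<in> \<sigma>" "x v = 0" using \<tau>(3) by (auto simp: geom_simplex_def)
  then show "(\<Prod>v\<in>\<sigma>. x v) = 0"
    using simplicial_complex_finite[OF K \<sigma>(1)] by (intro prod_zero) auto
qed

lemma off_skeleton_pos:
  assumes K: "simplicial_complex K" and x: "x \<in> polyhedron K" "x \<notin> polyhedron (skeleton d K)"
  shows "0 < off_skeleton d K x"
proof -
  obtain \<tau> where \<tau>: "\<tau> \<in> K" "x \<in> geom_simplex \<tau>" using x by blast
  have fin: "finite K" "finite \<tau>"
    using K simplicial_complex_finite[OF K \<tau>(1)] by (simp_all add: simplicial_complex_def)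
  define \<rho> where "\<rho> = {v\<in>\<tau>. x v \<noteq> 0}"
  have "sum x \<rho> = sum x \<tau>"
    unfolding \<rho>_def using fin by (intro sum.mono_neutral_left) auto
  then have x\<rho>: "x \<in> geom_simplex \<rho>" using \<tau>(2) by (auto simp: geom_simplex_def \<rho>_def)
  have "\<rho> \<noteq> {}" using x\<rho> by (auto simp: geom_simplex_def)
  then have "\<rho> \<in> K" by (intro simplicial_complex_face[OF K \<tau>(1)]) (auto simp: \<rho>_def)
  then have "\<not> card \<rho> \<le> d + 1" using x(2) x\<rho> by (auto simp: skeleton_def)
  then obtain \<sigma> where \<sigma>: "\<sigma> \<subseteq> \<rho>" "card \<sigma> = d + 2" "finite \<sigma>"
    using obtain_subset_with_card_n[of "d + 2" \<rho>] by (auto simp: not_le)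
  have "\<sigma> \<noteq> {}" using \<sigma>(2) by auto
  then have "\<sigma> \<in> K" by (rule simplicial_complex_face[OF K \<open>\<rho> \<in> K\<close> \<sigma>(1)])
  have nn: "0 \<le> x v" for v using \<tau>(2) by (simp add: geom_simplex_def)
  have "0 < x v" if "v \<in> \<sigma>" for v
    using that \<sigma>(1) nn[of v] by (auto simp: \<rho>_def order_le_less)
  then have "0 < (\<Prod>v\<in>\<sigma>. x v)" by (rule prod_pos)
  then show ?thesis unfolding off_skeleton_def
    using \<open>\<sigma> \<in> K\<close> \<sigma>(2) fin nn by (intro sum_pos2[of _ \<sigma>]) (auto intro: prod_nonneg)
qed

text \<open>Tietze extends each coordinate. Dividing by \<open>D\<close> changes nothing on the
  skeleton, where \<open>D = 1\<close>, and makes the norm less than 1 elsewhere, where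
  \<open>D\<close> exceeds the norm \<open>M\<close>.\<close>

lemma sphere_map_extension:
  fixes K :: "'a set set" and f :: "('a \<Rightarrow> real) \<Rightarrow> nat \<Rightarrow> real"
  assumes K: "simplicial_complex K"
    and f: "continuous_map (realization (skeleton d K)) (nsphere m) f"
  obtains F where "\<And>i. continuous_on (polyhedron K) (F i)"
    "\<And>i x. x \<in> polyhedron (skeleton d K) \<Longrightarrow> F i x = f x i"
    "\<And>x. x \<in> polyhedron K \<Longrightarrow> x \<notin> polyhedron (skeleton d K) \<Longrightarrow> (\<Sum>i\<le>m. (F i x)\<^sup>2) < 1"
proof -
  let ?P = "polyhedron K" and ?S = "polyhedron (skeleton d K)"
  have sub: "?S \<subseteq> ?P" by (auto simp: skeleton_def)
  have comp: "compact ?P" using K by (rule compact_polyhedron)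
  \<comment> \<open>The vertex type is arbitrary, so the product need not be metrizable; normality
    comes from compactness and the Hausdorff property.\<close>
  have "Hausdorff_space (powertop_real (UNIV::'a set))"
    by (simp add: Hausdorff_space_product_topology)
  then have "Hausdorff_space (top_of_set ?P)"
    by (simp add: euclidean_product_topology Hausdorff_space_subtopology)
  moreover have "compact_space (top_of_set ?P)"
    using comp by (simp add: compact_space_subtopology)
  ultimately have normal: "normal_space (top_of_set ?P)"
    by (intro compact_Hausdorff_or_regular_imp_normal_space) auto
  have clo: "closedin (top_of_set ?P) ?S"
    using closed_subset[OF sub closed_polyhedron[OF simplicial_complex_skeleton[OF K]]] .
  have "\<exists>g. continuous_on ?P g \<and> (\<forall>x\<in>?S. g x = f x i)" for i
  proof -
    have "continuous_map (subtopology (top_of_set ?P) ?S) euclideanreal (\<lambda>x. f x i)"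
      using continuous_map_compose[OF f continuous_map_nsphere_projection[of m i]] sub
      by (simp add: realization_eq subtopology_subtopology inf.absorb2 o_def)
    then show ?thesis
      using Tietze_extension_realinterval[OF normal clo is_interval_univ, of "\<lambda>x. f x i"]
      by (metis UNIV_not_empty continuous_map_iff_continuous subset_UNIV)
  qed
  then obtain g where g: "\<And>i. continuous_on ?P (g i)" "\<And>i x. x \<in> ?S \<Longrightarrow> g i x = f x i"
    by metis
  define M where "M = (\<lambda>x. sqrt (\<Sum>i\<le>m. (g i x)\<^sup>2))"
  define D where "D = (\<lambda>x. max 1 (M x) * (1 + \<bar>off_skeleton d K x\<bar>))"
  have Dpos: "0 < D x" for x unfolding D_def by (intro mult_pos_pos) auto
  have contM: "continuous_on ?P M" unfolding M_def by (intro continuous_intros g)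
  have contD: "continuous_on ?P D"
    unfolding D_def off_skeleton_def by (intro continuous_intros contM)
  show ?thesis
  proof
    show "continuous_on ?P (\<lambda>x. g i x / D x)" for i
      using Dpos by (intro continuous_intros g contD) (metis less_irrefl)
    show "g i x / D x = f x i" if x: "x \<in> ?S" for i x
    proof -
      have "f x \<in> topspace (nsphere m)"
        using f x by (auto simp: continuous_map_def realization_eq)
      then have "M x = 1" using g(2)[OF x] by (simp add: M_def nsphere)
      then show ?thesis using off_skeleton_eq_0[OF K x] g(2)[OF x] by (simp add: D_def)
    qed
    fix x assume x: "x \<in> ?P" "x \<notin> ?S"
    have "1 < 1 + \<bar>off_skeleton d K x\<bar>" using off_skeleton_pos[OF K x] by simp
    then have "max 1 (M x) * 1 < D x" unfolding D_def by (intro mult_strict_left_mono) auto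
    then have "M x < D x" by simp
    moreover have "0 \<le> M x" by (simp add: M_def sum_nonneg)
    ultimately have "(M x)\<^sup>2 < (D x)\<^sup>2" by (intro power_strict_mono) auto
    moreover have "(M x)\<^sup>2 = (\<Sum>i\<le>m. (g i x)\<^sup>2)" by (simp add: M_def sum_nonneg)
    ultimately show "(\<Sum>i\<le>m. (g i x / D x)\<^sup>2) < 1"
      using Dpos[of x] by (simp add: power_divide flip: sum_divide_distrib)
  qed
qed

lemma disjoint_geom_simplex:
  assumes "x \<in> geom_simplex \<sigma>" "y \<in> geom_simplex \<tau>" "\<sigma> \<inter> \<tau> = {}"
  shows "x \<noteq> y"
proof
  assume "x = y"
  then have "sum x \<sigma> = 0" using assms by (intro sum.neutral) (auto simp: geom_simplex_def)
  then show False using assms(1) by (simp add: geom_simplex_def)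
qed

section \<open>Radial maps between the sphere and the cube surface\<close>

lemma sup_norm_pos:
  assumes "x \<in> topspace (nsphere n)"
  shows "0 < sup_norm n x"
proof (rule ccontr)
  assume "\<not> ?thesis"
  then have "\<forall>j\<le>n. x j = 0" using abs_le_sup_norm[of _ n x] by fastforce
  then have "(\<Sum>j\<le>n. (x j)\<^sup>2) = 0" by simp
  then show False using assms by (simp add: nsphere)
qed

lemma sphere_to_cube:
  "continuous_map (nsphere n) (top_of_set (cube_surface n 1)) (\<lambda>x j. 1 / sup_norm n x * x j)"
proof -
  let ?S = "{x::nat \<Rightarrow> real. (\<Sum>i\<le>n. (x i)\<^sup>2) = 1 \<and> (\<forall>i>n. x i = 0)}"
  have N: "nsphere n = top_of_set ?S" by (simp add: nsphere euclidean_product_topology)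
  have pos: "0 < sup_norm n x" if "x \<in> ?S" for x using sup_norm_pos[of x n] that by (simp add: nsphere)
  then have "continuous_on ?S (\<lambda>x j. 1 / sup_norm n x * x j)"
    by (intro continuous_on_coordinatewise_then_product continuous_intros continuous_on_sup_norm) fastforce
  moreover have "(\<lambda>j. 1 / sup_norm n x * x j) \<in> cube_surface n 1" if "x \<in> ?S" for x
    using that pos[OF that] cube_surface_scale[of x n "sup_norm n x" "1 / sup_norm n x"] by (simp add: cube_surface_def)
  ultimately show ?thesis unfolding N by (auto simp: continuous_map_in_subtopology)
qed

lemma cube_to_sphere:
  "continuous_map (top_of_set (cube_surface n 1)) (nsphere n) (\<lambda>u j. u j / sqrt (\<Sum>i\<le>n. (u i)\<^sup>2))"
proof -
  have N: "nsphere n = top_of_set {x. (\<Sum>i\<le>n. (x i)\<^sup>2) = 1 \<and> (\<forall>i>n. x i = 0)}"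
    by (simp add: nsphere euclidean_product_topology)
  have pos: "0 < (\<Sum>i\<le>n. (u i)\<^sup>2)" if u: "u \<in> cube_surface n 1" for u
  proof -
    obtain j where "j \<le> n" "\<bar>u j\<bar> = 1" using sup_norm_attained[of n u] u by (auto simp: cube_surface_def)
    then show ?thesis by (intro sum_pos2[of _ j]) auto
  qed
  then have "continuous_on (cube_surface n 1) (\<lambda>u j. u j / sqrt (\<Sum>i\<le>n. (u i)\<^sup>2))"
    by (intro continuous_on_coordinatewise_then_product continuous_intros) fastforce
  moreover have "(\<Sum>j\<le>n. (u j / sqrt (\<Sum>i\<le>n. (u i)\<^sup>2))\<^sup>2) = 1" if "u \<in> cube_surface n 1" for u
    using pos[OF that] by (simp add: power_divide flip: sum_divide_distrib)
  ultimately show ?thesis unfolding N by (auto simp: continuous_map_in_subtopology cube_surface_def)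
qed

theorem theorem5:
  fixes K :: "'a set set" and d :: nat
  assumes "triangulated_sphere (2 * d + 1) K"
  shows "\<not> (\<exists>f. embedding_map (realization (skeleton d K)) (nsphere (2 * d)) f)"
proof
  define n where "n = 2 * d + 1"
  let ?P = "polyhedron K" and ?S = "polyhedron (skeleton d K)" and ?C = "cube_surface n 1"
  have K: "simplicial_complex K" and "realization K homeomorphic_space nsphere n"
    using assms by (simp_all add: triangulated_sphere_def n_def)
  then have "nsphere n homeomorphic_space realization K"
    using homeomorphic_space_sym by blast
  then obtain \<phi> where "homeomorphic_map (nsphere n) (top_of_set ?P) \<phi>"
    unfolding homeomorphic_space realization_eq by blast
  then have \<phi>: "continuous_map (nsphere n) (top_of_set ?P) \<phi>" "inj_on \<phi> (topspace (nsphere n))"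
    by (simp_all add: homeomorphic_eq_everything_map)
  assume "\<exists>f. embedding_map (realization (skeleton d K)) (nsphere (2 * d)) f"
  then obtain f where "embedding_map (realization (skeleton d K)) (nsphere (2 * d)) f" by blast
  then have f: "continuous_map (realization (skeleton d K)) (nsphere (2 * d)) f" "inj_on f ?S"
    by (auto simp: embedding_map_def homeomorphic_eq_everything_map continuous_map_in_subtopology realization_eq)
  define \<rho> where "\<rho> = (\<lambda>(u::nat \<Rightarrow> real) j. u j / sqrt (\<Sum>i\<le>n. (u i)\<^sup>2))"
  have \<rho>: "continuous_map (top_of_set ?C) (nsphere n) \<rho>"
    unfolding \<rho>_def by (rule cube_to_sphere)
  have \<rho>C: "\<rho> u \<in> topspace (nsphere n)" if "u \<in> ?C" for u
    using \<rho> that by (auto simp: continuous_map_def)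
  have cont\<phi>: "continuous_map (top_of_set ?C) (top_of_set ?P) (\<phi> \<circ> \<rho>)"
    using \<rho> \<phi>(1) by (rule continuous_map_compose)
  obtain p where p: "\<And>v. continuous_on ?C (\<lambda>u. p u v)"
    "\<And>u. u \<in> ?C \<Longrightarrow> \<exists>\<sigma>\<in>K. \<exists>\<sigma>'\<in>K. \<sigma> \<inter> \<sigma>' = {} \<and> card \<sigma> + card \<sigma>' \<le> n + 2
        \<and> p u \<in> geom_simplex \<sigma> \<and> p (\<lambda>j. - u j) \<in> geom_simplex \<sigma>'"
  proof (rule disjoint_faces_map[OF K, of n "\<phi> \<circ> \<rho>"])
    show "(\<phi> \<circ> \<rho>) u \<in> ?P" if "u \<in> ?C" for u
      using funcset_mem[OF continuous_map_funspace[OF cont\<phi>], of u] that by simp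
    show "(\<phi> \<circ> \<rho>) (\<lambda>j. - u j) \<noteq> (\<phi> \<circ> \<rho>) u" if u: "u \<in> ?C" for u
    proof
      assume "(\<phi> \<circ> \<rho>) (\<lambda>j. - u j) = (\<phi> \<circ> \<rho>) u"
      then have "\<rho> (\<lambda>j. - u j) = \<rho> u"
        using inj_onD[OF \<phi>(2)] \<rho>C[OF u] \<rho>C[OF cube_surface_uminus[OF u]] by simp
      then have "\<rho> u j = 0" for j by (auto simp: \<rho>_def fun_eq_iff)
      then show False using \<rho>C[OF u] by (simp add: nsphere)
    qed
    show "continuous_on ?C (\<lambda>u. (\<phi> \<circ> \<rho>) u v)" for v
      using cont\<phi> by (auto simp: continuous_map_in_subtopology intro: continuous_on_product_then_coordinatewise)
  qed (rule that)
  obtain F where F: "\<And>i. continuous_on ?P (F i)"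
    "\<And>i x. x \<in> ?S \<Longrightarrow> F i x = f x i"
    "\<And>x. x \<in> ?P \<Longrightarrow> x \<notin> ?S \<Longrightarrow> (\<Sum>i\<le>2 * d. (F i x)\<^sup>2) < 1"
    using sphere_map_extension[OF K f(1)] by metis
  \<comment> \<open>Points of the skeleton have images of norm 1 and all others of norm below 1, so
    equal images force \<open>y\<close> into the skeleton, where \<open>f\<close> is
    injective.\<close>
  have separate: "\<exists>i\<le>2 * d. F i x \<noteq> F i y" if "x \<in> ?S" "y \<in> ?P" "x \<noteq> y" for x y
  proof (rule ccontr)
    assume "\<not> ?thesis"
    then have eq: "\<And>i. i \<le> 2 * d \<Longrightarrow> F i y = f x i" using F(2)[OF that(1)] by auto
    have fS: "f z \<in> topspace (nsphere (2 * d))" if "z \<in> ?S" for z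
      using f(1) that by (auto simp: continuous_map_def realization_eq)
    have "(\<Sum>i\<le>2 * d. (F i y)\<^sup>2) = 1" using fS[OF that(1)] eq by (simp add: nsphere)
    then have y: "y \<in> ?S" using F(3)[OF that(2)] by force
    have "f y i = f x i" for i
      using eq[of i] F(2)[OF y, of i] fS[OF that(1)] fS[OF y] by (cases "i \<le> 2 * d") (auto simp: nsphere)
    then show False using inj_onD[OF f(2) _ y that(1)] that(3) by auto
  qed
  define y where "y = (\<lambda>(x::nat \<Rightarrow> real) j. 1 / sup_norm n x * x j)"
  have y: "continuous_map (nsphere n) (top_of_set ?C) y"
    unfolding y_def by (rule sphere_to_cube)
  have yC: "y x \<in> ?C" if "x \<in> topspace (nsphere n)" for x
    using y that by (auto simp: continuous_map_def)
  have y_uminus: "y (\<lambda>j. - x j) = (\<lambda>j. - y x j)" for x by (simp add: y_def)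
  have pP: "p u \<in> ?P" if "u \<in> ?C" for u using p(2)[OF that] by blast
  \<comment> \<open>The indices from 0 to \<open>2 * d\<close> give \<open>n\<close> odd functions
    on the \<open>n\<close>-sphere, the number that \<open>Borsuk_Ulam\<close> asks for.\<close>
  define G where "G = (\<lambda>i x. F i (p (y x)) - F i (p (\<lambda>j. - y x j)))"
  have "\<exists>x\<in>topspace (nsphere n). \<forall>i<n. G i x = 0"
  proof (rule Borsuk_Ulam)
    fix i
    have "continuous_on ?C p" by (intro continuous_on_coordinatewise_then_product p(1))
    then have Fp: "continuous_on ?C (\<lambda>u. F i (p u))"
      using pP by (intro continuous_on_compose2[OF F(1)]) auto
    have "continuous_on ?C (\<lambda>u. F i (p (\<lambda>j. - u j)))"
      by (rule continuous_on_compose2[OF Fp])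
        (auto intro!: continuous_intros continuous_on_coordinatewise_then_product cube_surface_uminus)
    then have "continuous_map (top_of_set ?C) euclideanreal (\<lambda>u. F i (p u) - F i (p (\<lambda>j. - u j)))"
      using Fp by (auto intro: continuous_intros)
    from continuous_map_compose[OF y this]
    show "continuous_map (nsphere n) euclideanreal (G i)"
      by (simp add: G_def o_def)
    show "G i (\<lambda>j. - x j) = - G i x" for x by (simp add: G_def y_uminus)
  qed
  then obtain x where x: "x \<in> topspace (nsphere n)" "\<And>i. i < n \<Longrightarrow> G i x = 0" by blast
  define u where "u = y x"
  have u: "u \<in> ?C" using yC[OF x(1)] by (simp add: u_def)
  have zero: "F i (p u) = F i (p (\<lambda>j. - u j))" if "i \<le> 2 * d" for i
    using x(2)[of i] that by (simp add: G_def u_def n_def)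
  obtain \<sigma> \<sigma>' where \<sigma>: "\<sigma> \<in> K" "\<sigma>' \<in> K" "\<sigma> \<inter> \<sigma>' = {}" "card \<sigma> + card \<sigma>' \<le> 2 * d + 3"
    "p u \<in> geom_simplex \<sigma>" "p (\<lambda>j. - u j) \<in> geom_simplex \<sigma>'"
    using p(2)[OF u] by (auto simp: n_def)
  have ne: "p u \<noteq> p (\<lambda>j. - u j)" using disjoint_geom_simplex[OF \<sigma>(5,6,3)] .
  \<comment> \<open>If both faces had at least \<open>d + 2\<close> vertices, the total would be at
    least \<open>2 * d + 4\<close>.\<close>
  have "card \<sigma> \<le> d + 1 \<or> card \<sigma>' \<le> d + 1" using \<sigma>(4) by linarith
  then have "p u \<in> ?S \<or> p (\<lambda>j. - u j) \<in> ?S" using \<sigma> by (auto simp: skeleton_def)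
  then show False
    using separate[of "p u" "p (\<lambda>j. - u j)"] separate[of "p (\<lambda>j. - u j)" "p u"]
      pP[OF u] pP[OF cube_surface_uminus[OF u]] ne zero by metis
qed

end
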